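(* Let $d\ge2$ and $q\ge1$. There are at most countably many $p\in[0,1]$ such that $\bar\mu^1_p\neq\bar\mu^0_p$.
   Context: For a finite connected (multi)graph $H$ with conductances $c$, $\Delta^H_cf(x)=\sum_{e=\{x,y\}}c_e(f(x)-f(y))$ acting on zero-sum functions on $\mathbf V(H)$, determinant $\det\Delta^H_c$. $\mathbb P^{H,p}(\kappa)\propto p^{h(\kappa)}(1-p)^{s(\kappa)}(\det\Delta^H_\kappa)^{-1/2}$ on $\{1,q\}^{\mathbf E(H)}$, $h,s$ counting edges with $\kappa_e=q$, resp. $1$. $\Lambda_n=[-n,n]^d\cap\mathbb Z^d$, $E_n$ its internal nearest-neighbour edges, $\partial\Lambda_n$ the vertices of $\Lambda_n$ with a neighbour outside, $\Lambda_n^w$ the multigraph from $(\Lambda_n,E_n)$ by identifying $\partial\Lambda_n$ to one vertex. $\bar\mu^0_p$, $\bar\mu^1_p$ are the limits as $n\to\infty$ (which exist, in the sense of convergence of probabilities of events depending on finitely many edges) of $\mathbb P^{\Lambda_n,p}$ and $\mathbb P^{\Lambda_n^w,p}$, respectively, as measures on $\{1,q\}^{\mathbf E(\mathbb Z^d)}$. *)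

theory Defs
  imports Complex_Main "HOL-Combinatorics.Permutations" "HOL-Library.FuncSet"
    "HOL-Library.Countable_Set"
begin

text \<open>A finite multigraph is given by a vertex set V, an edge set E and a map
  ends assigning to each edge its set of endpoints (two vertices, or one
  vertex for a loop).  Conductances c are functions on edges.\<close>

definition laplacian ::
  "'v set \<Rightarrow> 'e set \<Rightarrow> ('e \<Rightarrow> 'v set) \<Rightarrow> ('e \<Rightarrow> real) \<Rightarrow> ('v \<Rightarrow> real) \<Rightarrow> 'v \<Rightarrow> real" where
  "laplacian V E ends c f x =
     (\<Sum>e\<in>{e\<in>E. x \<in> ends e}. \<Sum>y\<in>ends e - {x}. c e * (f x - f y))"

definition det_on :: "'v set \<Rightarrow> ('v \<Rightarrow> 'v \<Rightarrow> real) \<Rightarrow> real" where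
  "det_on S M = (\<Sum>\<pi>\<in>{\<pi>. \<pi> permutes S}. of_int (sign \<pi>) * (\<Prod>y\<in>S. M y (\<pi> y)))"

text \<open>Determinant of the Laplacian acting on the space of zero-sum functions on V,
  computed as the determinant of its matrix with respect to the basis
  (delta_x - delta_r), x in V - {r}, for a fixed vertex r.\<close>
definition lap_det ::
  "'v set \<Rightarrow> 'e set \<Rightarrow> ('e \<Rightarrow> 'v set) \<Rightarrow> ('e \<Rightarrow> real) \<Rightarrow> real" where
  "lap_det V E ends c =
     (let r = (SOME r. r \<in> V);
          b = (\<lambda>x z. (if z = x then 1 else 0) - (if z = r then 1 else 0))
      in det_on (V - {r}) (\<lambda>y x. laplacian V E ends c (b x) y))"

definition configs :: "'e set \<Rightarrow> real \<Rightarrow> ('e \<Rightarrow> real) set" where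
  "configs E q = (E \<rightarrow>\<^sub>E {1, q})"

definition cfg_weight ::
  "'v set \<Rightarrow> 'e set \<Rightarrow> ('e \<Rightarrow> 'v set) \<Rightarrow> real \<Rightarrow> real \<Rightarrow> ('e \<Rightarrow> real) \<Rightarrow> real" where
  "cfg_weight V E ends p q \<kappa> =
     p ^ card {e\<in>E. \<kappa> e = q} * (1 - p) ^ card {e\<in>E. \<kappa> e = 1}
       * (lap_det V E ends \<kappa>) powr (-1/2)"

definition gprob ::
  "'v set \<Rightarrow> 'e set \<Rightarrow> ('e \<Rightarrow> 'v set) \<Rightarrow> real \<Rightarrow> real \<Rightarrow> ('e \<Rightarrow> real) set \<Rightarrow> real" where
  "gprob V E ends p q A =
     (\<Sum>\<kappa>\<in>configs E q \<inter> A. cfg_weight V E ends p q \<kappa>) /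
     (\<Sum>\<kappa>\<in>configs E q. cfg_weight V E ends p q \<kappa>)"

definition adj :: "nat \<Rightarrow> int list \<Rightarrow> int list \<Rightarrow> bool" where
  "adj d x y \<longleftrightarrow> length x = d \<and> length y = d \<and> (\<Sum>i<d. \<bar>x ! i - y ! i\<bar>) = 1"

definition Zd_edges :: "nat \<Rightarrow> int list set set" where
  "Zd_edges d = {{x, y} | x y. adj d x y}"

definition box :: "nat \<Rightarrow> nat \<Rightarrow> int list set" where
  "box d n = {x. length x = d \<and> (\<forall>i<d. \<bar>x ! i\<bar> \<le> int n)}"

definition box_edges :: "nat \<Rightarrow> nat \<Rightarrow> int list set set" where
  "box_edges d n = {e \<in> Zd_edges d. e \<subseteq> box d n}"

definition box_boundary :: "nat \<Rightarrow> nat \<Rightarrow> int list set" where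
  "box_boundary d n = {x \<in> box d n. \<exists>y. adj d x y \<and> y \<notin> box d n}"

definition wire :: "nat \<Rightarrow> nat \<Rightarrow> int list \<Rightarrow> int list option" where
  "wire d n x = (if x \<in> box_boundary d n then None else Some x)"

definition wbox :: "nat \<Rightarrow> nat \<Rightarrow> int list option set" where
  "wbox d n = wire d n ` box d n"

definition cyl_free :: "nat \<Rightarrow> real \<Rightarrow> real \<Rightarrow> nat \<Rightarrow> int list set set \<Rightarrow>
    (int list set \<Rightarrow> real) \<Rightarrow> real" where
  "cyl_free d p q n F \<xi> =
     gprob (box d n) (box_edges d n) (\<lambda>e. e) p q {\<kappa>. restrict \<kappa> F = \<xi>}"

definition cyl_wired :: "nat \<Rightarrow> real \<Rightarrow> real \<Rightarrow> nat \<Rightarrow> int list set set \<Rightarrow>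
    (int list set \<Rightarrow> real) \<Rightarrow> real" where
  "cyl_wired d p q n F \<xi> =
     gprob (wbox d n) (box_edges d n) (\<lambda>e. wire d n ` e) p q {\<kappa>. restrict \<kappa> F = \<xi>}"

text \<open>mu0 d p q F xi = bar mu^0_p(kappa|_F = xi), mu1 likewise for bar mu^1_p.\<close>
definition mu0 :: "nat \<Rightarrow> real \<Rightarrow> real \<Rightarrow> int list set set \<Rightarrow> (int list set \<Rightarrow> real) \<Rightarrow> real" where
  "mu0 d p q F \<xi> = lim (\<lambda>n. cyl_free d p q n F \<xi>)"

definition mu1 :: "nat \<Rightarrow> real \<Rightarrow> real \<Rightarrow> int list set set \<Rightarrow> (int list set \<Rightarrow> real) \<Rightarrow> real" where
  "mu1 d p q F \<xi> = lim (\<lambda>n. cyl_wired d p q n F \<xi>)"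

text \<open>Two measures on {1,q}^{E(Z^d)} (product sigma-algebra) differ iff they
  differ on some finite-dimensional cylinder event.\<close>
definition measures_differ :: "nat \<Rightarrow> real \<Rightarrow> real \<Rightarrow> bool" where
  "measures_differ d p q \<longleftrightarrow>
     (\<exists>F \<xi>. finite F \<and> F \<subseteq> Zd_edges d \<and> \<xi> \<in> F \<rightarrow>\<^sub>E {1, q} \<and> mu1 d p q F \<xi> \<noteq> mu0 d p q F \<xi>)"

end

theory Submission
  imports Defs "Jordan_Normal_Form.Determinant"
begin

text \<open>The determinant of the Laplacian changes by the factor
  \<open>1 + a R\<close> when the conductance of one edge grows by \<open>a\<close>, where \<open>R\<close> is the effective resistance
  across that edge. By Dirichlet's principle \<open>R\<close> decreases in the conductances and under gluing of
  vertices, so Holley's inequality gives all stochastic comparisons: monotonicity in \<open>p\<close>, free below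
  wired, free increasing and wired decreasing in the box.

  Gluing the boundary changes the partition function only by a constant, which does not depend on
  \<open>p\<close>, times \<open>exp (O(n^(d-1)))\<close>. By the mean value theorem the total edge densities of the wired and the
  free measure are therefore close at some parameter in any given interval \<open>(a, b)\<close>. Averaging over
  translates, the wired probability of an open edge at \<open>a\<close> is asymptotically at most the free one
  at \<open>b\<close>, so the two agree off the countably many jumps of an increasing function. Where all edge
  probabilities agree in the limit, so do the probabilities of all cylinder events.\<close>

section \<open>Determinants indexed by finite sets\<close>

text \<open>The obstacle is that \<open>lap_det\<close> is a signed sum over permutations relative
  to a chosen root, while the graphs to be compared have different vertex sets. Effective resistance
  is therefore used only through its variational description, as the best constant \<open>R\<close>
  in \<open>gsq h (ends e) \<le> R * energy E ends c h\<close>. A potential can be composed with any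
  vertex map, so enlarging a graph, gluing vertices and raising conductances become one argument,
  packaged in \<open>graph_map\<close>. The odds \<open>x = p / (1 - p)\<close> replace
  \<open>p\<close> because the partition function is then a polynomial in \<open>x\<close> whose
  logarithmic derivative is the total edge density divided by \<open>x\<close>. The bound for gluing
  comes from homogeneity: the determinants at the constant configurations \<open>q\<close> and 1
  differ by a power of \<open>q\<close> that counts vertices, so only the number \<open>K\<close> of
  vertices lost matters. Finite boxes are not translation invariant; in its place stands a one-sided
  comparison of a large box with a translate of a small one.\<close>

lemma det_on_eq_det:
  assumes h: "bij_betw h {0..<n} S"
  shows "det_on S M = det (mat n n (\<lambda>(i,j). M (h i) (h j)))"
proof -
  let ?T = "map_permutation {0..<n} h"
  let ?h' = "inv_into {0..<n} h"
  have inj: "inj_on h {0..<n}" and hS: "h ` {0..<n} = S" using h by (auto simp: bij_betw_def)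
  have h': "bij_betw ?h' S {0..<n}" by (rule bij_betw_inv_into[OF h])
  have "det (mat n n (\<lambda>(i,j). M (h i) (h j))) =
     (\<Sum>p | p permutes {0..<n}. of_int (sign p) * (\<Prod>i = 0..<n. M (h i) (h (p i))))"
    unfolding det_def by (auto intro!: sum.cong prod.cong simp: permutes_in_image)
  also have "\<dots> = det_on S M"
    unfolding det_on_def
  proof (rule sum.reindex_bij_witness[where j = ?T and i = "map_permutation S ?h'"])
    fix p assume "p \<in> {p. p permutes {0..<n}}"
    then have p: "p permutes {0..<n}" by simp
    show "map_permutation S ?h' (?T p) = p"
      by (rule map_permutation_compose_inv[OF h p]) (use inj in auto)
    show "?T p \<in> {\<pi>. \<pi> permutes S}" using map_permutation_permutes[OF h p] by simp
    have "(\<Prod>y\<in>S. M y (?T p y)) = (\<Prod>i=0..<n. M (h i) (?T p (h i)))"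
      unfolding hS[symmetric] by (simp add: prod.reindex[OF inj])
    also have "\<dots> = (\<Prod>i=0..<n. M (h i) (h (p i)))"
      by (intro prod.cong refl) (simp add: map_permutation_apply inj)
    finally show "of_int (sign (?T p)) * (\<Prod>y\<in>S. M y (?T p y)) =
        of_int (sign p) * (\<Prod>i = 0..<n. M (h i) (h (p i)))"
      by (simp add: sign_map_permutation[OF inj p])
  next
    fix p assume "p \<in> {p. p permutes S}"
    then have p: "p permutes S" by simp
    show "?T (map_permutation S ?h' p) = p"
      by (rule map_permutation_compose_inv[OF h' p]) (use hS in \<open>auto intro: f_inv_into_f\<close>)
    show "map_permutation S ?h' p \<in> {\<pi>. \<pi> permutes {0..<n}}"
      using map_permutation_permutes[OF h' p] by simp
  qed
  finally show ?thesis by simp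
qed

lemma det_on_zero_kernel:
  assumes "finite S" "det_on S M = 0"
  obtains g where "\<exists>x\<in>S. g x \<noteq> 0" "\<And>y. y \<in> S \<Longrightarrow> (\<Sum>x\<in>S. M y x * g x) = 0"
proof -
  obtain h where h: "bij_betw h {0..<card S} S"
    using ex_bij_betw_nat_finite[OF assms(1)] by blast
  define n where "n = card S"
  have inj: "inj_on h {0..<n}" and hS: "h ` {0..<n} = S" using h by (auto simp: bij_betw_def n_def)
  let ?A = "mat n n (\<lambda>(i,j). M (h i) (h j))"
  have A: "?A \<in> carrier_mat n n" by simp
  have "det ?A = 0" using det_on_eq_det[OF h, of M] assms(2) by (simp add: n_def)
  then obtain v where v: "v \<in> carrier_vec n" "v \<noteq> 0\<^sub>v n" "?A *\<^sub>v v = 0\<^sub>v n"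
    using det_0_iff_vec_prod_zero[OF A] by blast
  define g where "g x = v $ (inv_into {0..<n} h x)" for x
  have gh: "g (h i) = v $ i" if "i < n" for i using that inj by (simp add: g_def)
  obtain i where i: "i < n" "v $ i \<noteq> 0" using v(1,2) by (metis eq_vecI carrier_vecD index_zero_vec)
  show ?thesis
  proof
    show "\<exists>x\<in>S. g x \<noteq> 0" using i gh hS by (intro bexI[of _ "h i"]) auto
    fix y assume "y \<in> S"
    then obtain k where k: "k < n" "y = h k" using hS by force
    have "(\<Sum>x\<in>S. M y x * g x) = (\<Sum>i=0..<n. M (h k) (h i) * v $ i)"
      unfolding hS[symmetric] k by (simp add: sum.reindex[OF inj] gh)
    also have "\<dots> = (?A *\<^sub>v v) $ k" using k v(1) by (simp add: scalar_prod_def)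
    also have "\<dots> = 0" using v(3) k by simp
    finally show "(\<Sum>x\<in>S. M y x * g x) = 0" .
  qed
qed

lemma det_on_solve:
  assumes "finite S" "det_on S M \<noteq> 0"
  obtains w where "\<And>y. y \<in> S \<Longrightarrow> (\<Sum>x\<in>S. M y x * w x) = u y"
proof -
  obtain h where h: "bij_betw h {0..<card S} S"
    using ex_bij_betw_nat_finite[OF assms(1)] by blast
  define n where "n = card S"
  have inj: "inj_on h {0..<n}" and hS: "h ` {0..<n} = S" using h by (auto simp: bij_betw_def n_def)
  let ?A = "mat n n (\<lambda>(i,j). M (h i) (h j))"
  have A: "?A \<in> carrier_mat n n" by simp
  have d: "det ?A = det_on S M" using det_on_eq_det[OF h, of M] by (simp add: n_def)
  let ?u = "vec n (\<lambda>i. u (h i) / det ?A)"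
  \<comment> \<open>Cramer's rule: the adjugate inverts the matrix up to \<open>det ?A\<close>,
    which has already been divided out in \<open>?u\<close>.\<close>
  define v where "v = adj_mat ?A *\<^sub>v ?u"
  have v: "v \<in> carrier_vec n" unfolding v_def using adj_mat(1)[OF A] by simp
  have "?A *\<^sub>v v = (?A * adj_mat ?A) *\<^sub>v ?u"
    unfolding v_def by (rule assoc_mult_mat_vec[symmetric, OF A adj_mat(1)[OF A]]) simp
  also have "\<dots> = det ?A \<cdot>\<^sub>v ?u" unfolding adj_mat(2)[OF A] by auto
  finally have Av: "?A *\<^sub>v v = det ?A \<cdot>\<^sub>v ?u" .
  define g where "g x = v $ (inv_into {0..<n} h x)" for x
  have gh: "g (h i) = v $ i" if "i < n" for i using that inj by (simp add: g_def)
  show ?thesis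
  proof
    fix y assume "y \<in> S"
    then obtain k where k: "k < n" "y = h k" using hS by force
    have "(\<Sum>x\<in>S. M y x * g x) = (\<Sum>i=0..<n. M (h k) (h i) * v $ i)"
      unfolding hS[symmetric] k by (simp add: sum.reindex[OF inj] gh)
    also have "\<dots> = (?A *\<^sub>v v) $ k" using k v by (simp add: scalar_prod_def)
    also have "\<dots> = u y" unfolding Av using k d assms(2) by simp
    finally show "(\<Sum>x\<in>S. M y x * g x) = u y" .
  qed
qed

text \<open>The block matrix with rows \<open>(1, v)\<close> and \<open>(-a w, I)\<close> is
  factored in two ways, by taking the Schur complement of either diagonal block. One complement is
  the \<open>n\<close> by \<open>n\<close> matrix, the other is the scalar on the right, and the
  remaining factors have determinant 1.\<close>

lemma det_one_plus_rank1:
  fixes w v :: "real vec"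
  assumes w: "w \<in> carrier_vec n" and v: "v \<in> carrier_vec n"
  shows "det (mat n n (\<lambda>(i,j). (if i = j then 1 else 0) + a * w $ i * v $ j)) = 1 + a * (v \<bullet> w)"
proof -
  let ?B = "mat n n (\<lambda>(i,j). (if i = j then 1 else 0) + a * w $ i * v $ j)"
  let ?V = "mat 1 n (\<lambda>(i,j). v $ j)" and ?W = "mat n 1 (\<lambda>(i,j). - a * w $ i)"
  let ?s = "mat 1 1 (\<lambda>_. 1 + a * (v \<bullet> w))"
  let ?I = "1\<^sub>m n :: real mat" and ?i = "1\<^sub>m 1 :: real mat"
  let ?L = "four_block_mat ?i (0\<^sub>m 1 n) ?W ?I"
  have 1: "?L * four_block_mat ?i ?V (0\<^sub>m n 1) ?B = four_block_mat ?i ?V ?W ?I"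
  proof -
    have e1: "?i * ?i + 0\<^sub>m 1 n * 0\<^sub>m n 1 = ?i" by simp
    have e2: "?i * ?V + 0\<^sub>m 1 n * ?B = ?V" by simp
    have e3: "?W * ?i + ?I * 0\<^sub>m n 1 = ?W" by simp
    have e4: "?W * ?V + ?I * ?B = ?I" by (rule eq_matI) (auto simp: scalar_prod_def)
    show ?thesis
      by (subst mult_four_block_mat[of _ 1 1 _ n _ n _ _ 1 _ n]) (simp_all only: e1 e2 e3 e4, simp_all)
  qed
  have 2: "four_block_mat ?s ?V (0\<^sub>m n 1) ?I * ?L = four_block_mat ?i ?V ?W ?I"
  proof -
    have e1: "?s * ?i + ?V * ?W = ?i"
      using v w by (intro eq_matI) (auto simp: scalar_prod_def sum_distrib_left algebra_simps sum_negf)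
    have e2: "?s * 0\<^sub>m 1 n + ?V * ?I = ?V" by simp
    have e3: "0\<^sub>m n 1 * ?i + ?I * ?W = ?W" by simp
    have e4: "0\<^sub>m n 1 * 0\<^sub>m 1 n + ?I * ?I = ?I" by simp
    show ?thesis
      by (subst mult_four_block_mat[of _ 1 1 _ n _ n _ _ 1 _ n]) (simp_all only: e1 e2 e3 e4, simp_all)
  qed
  have L: "det ?L = 1"
    by (subst det_four_block_mat_upper_right_zero[of _ 1 _ n]) simp_all
  have "det ?B = det (four_block_mat ?i ?V (0\<^sub>m n 1) ?B)"
    by (subst det_four_block_mat_lower_left_zero[of _ 1 _ n]) simp_all
  also have "\<dots> = det ?L * det (four_block_mat ?i ?V (0\<^sub>m n 1) ?B)"
    unfolding L by (rule mult_1[symmetric])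
  also have "\<dots> = det (?L * four_block_mat ?i ?V (0\<^sub>m n 1) ?B)"
    by (rule det_mult[symmetric, of _ "1 + n"]) (rule four_block_carrier_mat; simp)+
  also have "\<dots> = det (four_block_mat ?s ?V (0\<^sub>m n 1) ?I * ?L)"
    unfolding 1 2 ..
  also have "\<dots> = det (four_block_mat ?s ?V (0\<^sub>m n 1) ?I) * det ?L"
    by (rule det_mult[of _ "1 + n"]) (rule four_block_carrier_mat; simp)+
  also have "\<dots> = det (four_block_mat ?s ?V (0\<^sub>m n 1) ?I)"
    unfolding L by (rule mult_1_right)
  also have "\<dots> = 1 + a * (v \<bullet> w)"
    by (subst det_four_block_mat_lower_left_zero[of _ 1 _ n]) (simp_all add: det_single)
  finally show ?thesis .
qed

text \<open>Because \<open>u = M w\<close>, the perturbed matrix is \<open>M\<close> times the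
  identity plus \<open>a w v^T\<close>, and \<open>det_one_plus_rank1\<close> applies to the second
  factor.\<close>

lemma det_on_rank1:
  assumes "finite S" and w: "\<And>y. y \<in> S \<Longrightarrow> (\<Sum>x\<in>S. M y x * w x) = u y"
  shows "det_on S (\<lambda>y x. M y x + a * u y * v x) = det_on S M * (1 + a * (\<Sum>x\<in>S. v x * w x))"
proof -
  obtain h where h': "bij_betw h {0..<card S} S"
    using ex_bij_betw_nat_finite[OF assms(1)] by blast
  define n where "n = card S"
  have h: "bij_betw h {0..<n} S" using h' n_def by simp
  have inj: "inj_on h {0..<n}" and hS: "h ` {0..<n} = S" using h by (auto simp: bij_betw_def)
  let ?A = "mat n n (\<lambda>(i,j). M (h i) (h j))"
  let ?w = "vec n (\<lambda>i. w (h i))" and ?v = "vec n (\<lambda>i. v (h i))"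
  let ?B = "mat n n (\<lambda>(i,j). (if i = j then 1 else 0) + a * ?w $ i * ?v $ j)"
  have Mw: "(\<Sum>k=0..<n. M (h i) (h k) * w (h k)) = u (h i)" if "i < n" for i
  proof -
    have "h i \<in> S" using that hS by auto
    from w[OF this] show ?thesis unfolding hS[symmetric] by (simp add: sum.reindex[OF inj])
  qed
  have "mat n n (\<lambda>(i,j). M (h i) (h j) + a * u (h i) * v (h j)) = ?A * ?B"
  proof (rule eq_matI)
    fix i j assume "i < dim_row (?A * ?B)" "j < dim_col (?A * ?B)"
    then have ij: "i < n" "j < n" by auto
    have "(?A * ?B) $$ (i, j) = (\<Sum>k=0..<n. M (h i) (h k) * ((if k = j then 1 else 0) + a * w (h k) * v (h j)))"
      using ij by (simp add: scalar_prod_def)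
    also have "\<dots> = (\<Sum>k=0..<n. (if k = j then M (h i) (h k) else 0) + a * v (h j) * (M (h i) (h k) * w (h k)))"
      by (intro sum.cong refl) (simp add: algebra_simps)
    also have "\<dots> = M (h i) (h j) + a * v (h j) * u (h i)"
      using ij by (simp add: sum.distrib sum_distrib_left[symmetric] Mw)
    finally show "mat n n (\<lambda>(i,j). M (h i) (h j) + a * u (h i) * v (h j)) $$ (i, j) = (?A * ?B) $$ (i, j)"
      using ij by simp
  qed auto
  then have "det_on S (\<lambda>y x. M y x + a * u y * v x) = det (?A * ?B)"
    using det_on_eq_det[OF h] by simp
  also have "\<dots> = det ?A * det ?B" by (rule det_mult[of _ n]) auto
  also have "det ?B = 1 + a * (?v \<bullet> ?w)" by (rule det_one_plus_rank1) auto
  also have "?v \<bullet> ?w = (\<Sum>x\<in>S. v x * w x)"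
    by (simp add: scalar_prod_def hS[symmetric] sum.reindex[OF inj])
  also have "det ?A = det_on S M" using det_on_eq_det[OF h] by simp
  finally show ?thesis .
qed

lemma det_on_id:
  assumes "finite S"
  shows "det_on S (\<lambda>y x. if y = x then 1 else 0) = 1"
proof -
  obtain h where h: "bij_betw h {0..<card S} S"
    using ex_bij_betw_nat_finite[OF assms(1)] by blast
  then have "inj_on h {0..<card S}" by (simp add: bij_betw_def)
  then have "mat (card S) (card S) (\<lambda>(i,j). if h i = h j then 1 else 0) = (1\<^sub>m (card S) :: real mat)"
    by (intro eq_matI) (auto simp: inj_on_eq_iff)
  then show ?thesis using det_on_eq_det[OF h] by simp
qed

lemma det_on_smult: "det_on S (\<lambda>x y. k * M x y) = k ^ card S * det_on S M"
  unfolding det_on_def by (simp add: prod.distrib sum_distrib_left algebra_simps)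

section \<open>Effective resistance\<close>

text \<open>The squared potential difference across an edge, read off its unordered endpoint set. It
  is 0 on a loop and commutes with taking images of the endpoint set, so no orientation has to be
  carried along vertex maps.\<close>

definition gsq :: "('v \<Rightarrow> real) \<Rightarrow> 'v set \<Rightarrow> real" where
  "gsq f X = (Max (f ` X) - Min (f ` X))\<^sup>2"

definition energy :: "'e set \<Rightarrow> ('e \<Rightarrow> 'v set) \<Rightarrow> ('e \<Rightarrow> real) \<Rightarrow> ('v \<Rightarrow> real) \<Rightarrow> real" where
  "energy E ends c f = (\<Sum>e\<in>E. c e * gsq f (ends e))"

lemma gsq_pair: "gsq f {x, y} = (f x - f y)\<^sup>2"
  by (auto simp: gsq_def max_def min_def power2_commute)

lemma gsq_image: "gsq f (\<phi> ` X) = gsq (\<lambda>x. f (\<phi> x)) X"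
  by (simp add: gsq_def image_image)

lemma gsq_nonneg: "gsq f X \<ge> 0"
  by (simp add: gsq_def)

lemma square_le_of_quadratic_nonneg:
  fixes A B C :: real
  assumes "\<And>t. 0 \<le> A - 2 * t * B + t\<^sup>2 * C" "C \<ge> 0"
  shows "B\<^sup>2 \<le> A * C"
proof (cases "C = 0")
  case True
  have "B = 0"
  proof (rule ccontr)
    assume "B \<noteq> 0"
    \<comment> \<open>At this value of \<open>t\<close> the expression, linear since
      \<open>C = 0\<close>, equals -1.\<close>
    with assms(1)[of "(A + 1) / (2 * B)"] True show False by simp
  qed
  then show ?thesis using True by simp
next
  case False
  with False assms(2) have "C > 0" by simp
  with assms(1)[of "B / C"] show ?thesis by (simp add: power2_eq_square field_simps)
qed

text \<open>Connectedness is stated through functions that are constant along edges. This is the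
  form in which vanishing energy is exploited, and it passes to quotients by pulling functions
  back.\<close>

locale cgraph =
  fixes V :: "'v set" and E :: "'e set" and ends :: "'e \<Rightarrow> 'v set"
  assumes fin_V: "finite V" and fin_E: "finite E" and V_ne: "V \<noteq> {}"
    and ends_pair: "\<And>e. e \<in> E \<Longrightarrow> \<exists>x\<in>V. \<exists>y\<in>V. ends e = {x, y}"
    and connected: "\<And>(f :: 'v \<Rightarrow> real) x y. (\<And>e x y. e \<in> E \<Longrightarrow> x \<in> ends e \<Longrightarrow> y \<in> ends e \<Longrightarrow> f x = f y) \<Longrightarrow>
      x \<in> V \<Longrightarrow> y \<in> V \<Longrightarrow> f x = f y"
begin

text \<open>An arbitrary orientation of the edges. It makes Laplacian and energy plain sums over
  edges; reversing an edge flips two signs at once, and on a loop \<open>unit_flow\<close>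
  vanishes.\<close>

definition endpts :: "'e \<Rightarrow> 'v \<times> 'v" where
  "endpts e = (SOME p. fst p \<in> V \<and> snd p \<in> V \<and> ends e = {fst p, snd p})"

abbreviation "src e \<equiv> fst (endpts e)"
abbreviation "tgt e \<equiv> snd (endpts e)"
abbreviation "unit_flow e z \<equiv> (if z = src e then 1 else 0) - (if z = tgt e then 1 else (0::real))"

lemma endpts:
  assumes "e \<in> E"
  shows "src e \<in> V" "tgt e \<in> V" "ends e = {src e, tgt e}"
proof -
  from ends_pair[OF assms] obtain x y where "x \<in> V" "y \<in> V" "ends e = {x, y}" by blast
  then have "\<exists>p. fst p \<in> V \<and> snd p \<in> V \<and> ends e = {fst p, snd p}" by (intro exI[of _ "(x, y)"]) simp
  from someI_ex[OF this] show "src e \<in> V" "tgt e \<in> V" "ends e = {src e, tgt e}"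
    by (auto simp: endpts_def)
qed

lemma gsq_ends: "e \<in> E \<Longrightarrow> gsq f (ends e) = (f (src e) - f (tgt e))\<^sup>2"
  using endpts(3) gsq_pair by metis

lemma laplacian_eq:
  "laplacian V E ends c f z = (\<Sum>e\<in>E. c e * (f (src e) - f (tgt e)) * unit_flow e z)"
proof -
  have "laplacian V E ends c f z =
      (\<Sum>e\<in>E. if z \<in> ends e then \<Sum>y\<in>ends e - {z}. c e * (f z - f y) else 0)"
    unfolding laplacian_def by (rule sum.inter_filter[OF fin_E])
  also have "\<dots> = (\<Sum>e\<in>E. c e * (f (src e) - f (tgt e)) * unit_flow e z)"
  proof (rule sum.cong[OF refl])
    fix e assume "e \<in> E"
    from endpts(3)[OF this] have e: "ends e = {src e, tgt e}" .
    show "(if z \<in> ends e then \<Sum>y\<in>ends e - {z}. c e * (f z - f y) else 0)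
        = c e * (f (src e) - f (tgt e)) * unit_flow e z"
    proof (cases "src e = tgt e")
      case True
      then show ?thesis unfolding e by auto
    next
      case False
      then have "{src e, tgt e} - {src e} = {tgt e}" "{src e, tgt e} - {tgt e} = {src e}" by auto
      then show ?thesis unfolding e using False by (auto simp: algebra_simps)
    qed
  qed
  finally show ?thesis .
qed

lemma sum_unit_flow: "e \<in> E \<Longrightarrow> (\<Sum>z\<in>V. h z * unit_flow e z) = h (src e) - h (tgt e)"
  using endpts[of e] fin_V
  by (simp add: right_diff_distrib sum_subtractf if_distrib[of "\<lambda>x. _ * x"] cong: if_cong)

text \<open>Summation by parts, the discrete Green identity. The right side is symmetric in
  \<open>f\<close> and \<open>h\<close> and is the bilinear form behind
  \<open>energy\<close>.\<close>

lemma sum_laplacian: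
  "(\<Sum>z\<in>V. h z * laplacian V E ends c f z) =
     (\<Sum>e\<in>E. c e * (f (src e) - f (tgt e)) * (h (src e) - h (tgt e)))"
proof -
  have "(\<Sum>z\<in>V. h z * laplacian V E ends c f z) =
      (\<Sum>e\<in>E. \<Sum>z\<in>V. c e * (f (src e) - f (tgt e)) * (h z * unit_flow e z))"
    unfolding laplacian_eq sum_distrib_left by (subst sum.swap) (simp only: mult_ac)
  then show ?thesis
    by (simp add: sum_distrib_left[symmetric] sum_unit_flow cong: sum.cong)
qed

lemma energy_eq: "energy E ends c f = (\<Sum>e\<in>E. c e * (f (src e) - f (tgt e))\<^sup>2)"
  unfolding energy_def by (intro sum.cong refl) (simp add: gsq_ends)

lemma sum_laplacian_self: "(\<Sum>z\<in>V. f z * laplacian V E ends c f z) = energy E ends c f"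
  unfolding sum_laplacian energy_eq by (simp add: power2_eq_square mult_ac)

lemma sum_laplacian_zero: "(\<Sum>z\<in>V. laplacian V E ends c f z) = 0"
  using sum_laplacian[of "\<lambda>_. 1" c f] by simp

lemma energy_nonneg:
  assumes "\<And>e. e \<in> E \<Longrightarrow> c e > 0"
  shows "energy E ends c f \<ge> 0"
  unfolding energy_def using assms by (intro sum_nonneg) (simp add: gsq_nonneg less_imp_le)

lemma energy_zero_imp_const:
  assumes c: "\<And>e. e \<in> E \<Longrightarrow> c e > 0" and "energy E ends c f = 0" and V: "x \<in> V" "y \<in> V"
  shows "f x = f y"
proof (rule connected[OF _ V])
  fix e x y assume e: "e \<in> E" "x \<in> ends e" "y \<in> ends e"
  have "c e * (f (src e) - f (tgt e))\<^sup>2 = 0"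
    using assms(2) unfolding energy_eq
    by (subst (asm) sum_nonneg_eq_0_iff[OF fin_E]) (use c e in \<open>auto simp: less_imp_le\<close>)
  with c[OF e(1)] have "f (src e) = f (tgt e)" by simp
  with e endpts(3)[OF e(1)] show "f x = f y" by auto
qed

lemma energy_cauchy_schwarz:
  assumes c: "\<And>e. e \<in> E \<Longrightarrow> c e > 0"
  shows "(\<Sum>z\<in>V. h z * laplacian V E ends c f z)\<^sup>2 \<le> energy E ends c h * energy E ends c f"
proof (rule square_le_of_quadratic_nonneg)
  fix t
  have "0 \<le> energy E ends c (\<lambda>z. h z - t * f z)" by (rule energy_nonneg[of c, OF c])
  also have "\<dots> = energy E ends c h - 2 * t * (\<Sum>z\<in>V. h z * laplacian V E ends c f z) + t\<^sup>2 * energy E ends c f"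
    unfolding energy_eq sum_laplacian sum_distrib_left sum_subtractf[symmetric] sum.distrib[symmetric]
    by (intro sum.cong refl) (simp add: power2_eq_square algebra_simps)
  finally show "0 \<le> energy E ends c h - 2 * t * (\<Sum>z\<in>V. h z * laplacian V E ends c f z) + t\<^sup>2 * energy E ends c f" .
qed (rule energy_nonneg[of c, OF c])

section \<open>The Laplacian matrix on zero-sum functions\<close>

definition root :: 'v where "root = (SOME r. r \<in> V)"
abbreviation "bvec x z \<equiv> (if z = x then 1 else 0) - (if z = root then 1 else (0::real))"
text \<open>The zero-sum function with coordinates \<open>g\<close> in the basis used by
  \<open>lap_det\<close>. Off the root its values are the coordinates themselves.\<close>

definition expand :: "('v \<Rightarrow> real) \<Rightarrow> 'v \<Rightarrow> real" where
  "expand g z = (\<Sum>x\<in>V - {root}. g x * bvec x z)"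

lemma root_in: "root \<in> V"
  unfolding root_def using V_ne by (simp add: some_in_eq)

lemma lap_det_eq: "lap_det V E ends c = det_on (V - {root}) (\<lambda>y x. laplacian V E ends c (bvec x) y)"
  unfolding lap_det_def Let_def root_def[symmetric] ..

lemma expand_apply: "y \<in> V - {root} \<Longrightarrow> expand g y = g y"
  unfolding expand_def using fin_V by (simp add: if_distrib[of "\<lambda>x. _ * x"] cong: if_cong)

lemma expand_root: "expand g root = - (\<Sum>x\<in>V - {root}. g x)"
proof -
  have "expand g root = (\<Sum>x\<in>V - {root}. - g x)"
    unfolding expand_def by (intro sum.cong refl) auto
  then show ?thesis by (simp add: sum_negf)
qed

lemma sum_V_root: "(\<Sum>z\<in>V. f z) = f root + (\<Sum>z\<in>V - {root}. f z)"
  by (rule sum.remove[OF fin_V root_in])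

lemma sum_expand: "(\<Sum>z\<in>V. expand g z) = 0"
  unfolding sum_V_root expand_root using sum.cong[OF refl expand_apply[of _ g], of "V - {root}"] by simp

text \<open>Linearity in the basis coefficients. Matrix-vector equations for the matrix in
  \<open>lap_det\<close> thereby become equations between functions on the graph.\<close>

lemma laplacian_expand:
  "(\<Sum>x\<in>V - {root}. laplacian V E ends c (bvec x) y * g x) = laplacian V E ends c (expand g) y"
proof -
  have "(\<Sum>x\<in>V - {root}. laplacian V E ends c (bvec x) y * g x) =
     (\<Sum>e\<in>E. \<Sum>x\<in>V - {root}. (c e * unit_flow e y) * (g x * bvec x (src e) - g x * bvec x (tgt e)))"
    unfolding laplacian_eq sum_distrib_right
    by (subst sum.swap, intro sum.cong refl) (simp add: algebra_simps)
  also have "\<dots> = (\<Sum>e\<in>E. (c e * unit_flow e y) * (expand g (src e) - expand g (tgt e)))"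
    unfolding sum_distrib_left[symmetric] sum_subtractf expand_def ..
  also have "\<dots> = laplacian V E ends c (expand g) y"
    unfolding laplacian_eq by (intro sum.cong refl) (simp only: mult_ac)
  finally show ?thesis .
qed

text \<open>The matrix has no row for the root, so its equations hold only off the root; equality of
  the total sums supplies the missing value.\<close>

lemma zero_sum_ext:
  assumes "\<And>y. y \<in> V - {root} \<Longrightarrow> f y = (g y :: real)" "sum f V = sum g V" "y \<in> V"
  shows "f y = g y"
proof (cases "y = root")
  case True
  have "sum f (V - {root}) = sum g (V - {root})" by (rule sum.cong) (use assms in auto)
  then show ?thesis using assms(2) True unfolding sum_V_root by simp
qed (use assms in auto)

text \<open>The matrix is deformed linearly to the identity. Along the way the associated quadratic
  form stays positive definite on zero-sum functions, so the determinant never vanishes.\<close>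
lemma lap_det_pos:
  assumes c: "\<And>e. e \<in> E \<Longrightarrow> c e > 0"
  shows "lap_det V E ends c > 0"
proof (rule ccontr)
  let ?M = "\<lambda>y x. laplacian V E ends c (bvec x) y" and ?S = "V - {root}"
  define P where "P t = det_on ?S (\<lambda>y x. (1 - t) * (if y = x then 1 else 0) + t * ?M y x)" for t :: real
  assume "\<not> lap_det V E ends c > 0"
  then have P1: "P 1 \<le> 0" by (simp add: P_def lap_det_eq)
  have P0: "P 0 = 1" using det_on_id[of ?S] fin_V by (simp add: P_def)
  have "continuous_on {0..1} P" unfolding P_def det_on_def by (intro continuous_intros)
  with P0 P1 obtain t where t: "0 \<le> t" "t \<le> 1" "P t = 0"
    using IVT2'[of P 1 0 0] by auto
  have "finite ?S" using fin_V by simp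
  then obtain g where g: "\<exists>x\<in>?S. g x \<noteq> 0"
      "\<And>y. y \<in> ?S \<Longrightarrow> (\<Sum>x\<in>?S. ((1 - t) * (if y = x then 1 else 0) + t * ?M y x) * g x) = 0"
    by (rule det_on_zero_kernel[OF _ t(3)[unfolded P_def]]) (rule that)
  let ?f = "expand g"
  have eq: "(1 - t) * ?f y + t * laplacian V E ends c ?f y = 0" if "y \<in> V" for y
  proof (rule zero_sum_ext[where f = "\<lambda>y. (1 - t) * ?f y + t * laplacian V E ends c ?f y" and g = "\<lambda>_. 0", OF _ _ that])
    fix y assume y: "y \<in> ?S"
    have "(\<Sum>x\<in>?S. ((1 - t) * (if y = x then 1 else 0) + t * ?M y x) * g x)
        = (\<Sum>x\<in>?S. (if y = x then (1 - t) * g x else 0) + t * (?M y x * g x))"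
      by (intro sum.cong refl) (simp add: distrib_right)
    also have "\<dots> = (1 - t) * ?f y + t * laplacian V E ends c ?f y"
      using y fin_V unfolding sum.distrib sum_distrib_left[symmetric] laplacian_expand
      by (simp add: expand_apply)
    finally show "(1 - t) * ?f y + t * laplacian V E ends c ?f y = 0" using g(2)[OF y] by linarith
  qed (simp add: sum.distrib sum_distrib_left[symmetric] sum_expand sum_laplacian_zero)
  have "0 = (\<Sum>y\<in>V. ?f y * ((1 - t) * ?f y + t * laplacian V E ends c ?f y))"
    by (simp add: eq)
  also have "\<dots> = (1 - t) * (\<Sum>y\<in>V. (?f y)\<^sup>2) + t * energy E ends c ?f"
    unfolding sum_laplacian_self[symmetric] sum_distrib_left sum.distrib[symmetric]
    by (intro sum.cong refl) (simp add: power2_eq_square algebra_simps)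
  finally have z: "(1 - t) * (\<Sum>y\<in>V. (?f y)\<^sup>2) + t * energy E ends c ?f = 0" by simp
  have n1: "(1 - t) * (\<Sum>y\<in>V. (?f y)\<^sup>2) \<ge> 0" using t by (intro mult_nonneg_nonneg sum_nonneg) auto
  have n2: "t * energy E ends c ?f \<ge> 0" using t energy_nonneg[of c, OF c] by simp
  from z n1 n2 have z1: "(1 - t) * (\<Sum>y\<in>V. (?f y)\<^sup>2) = 0" and z2: "t * energy E ends c ?f = 0" by linarith+
  \<comment> \<open>For \<open>t = 1\<close> only the energy survives: \<open>?f\<close> is constant
    by connectedness, and its zero sum makes it 0. For \<open>t < 1\<close> the sum of squares
    already forces this.\<close>
  have "?f y = 0" if y: "y \<in> V" for y
  proof (cases "t = 1")
    case True
    then have "energy E ends c ?f = 0" using z2 by simp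
    from energy_zero_imp_const[of c, OF c this _ y] have "?f z = ?f y" if "z \<in> V" for z using that by blast
    then have "(\<Sum>z\<in>V. ?f z) = real (card V) * ?f y" by simp
    then show ?thesis using sum_expand[of g] fin_V V_ne by simp
  next
    case False
    then have "(\<Sum>y\<in>V. (?f y)\<^sup>2) = 0" using z1 by simp
    then show ?thesis using y fin_V by (subst (asm) sum_nonneg_eq_0_iff) auto
  qed
  then show False using g(1) expand_apply by force
qed

text \<open>Changing one conductance is a rank-one perturbation in the direction of the unit flow
  through \<open>e\<close>. Solving the Laplace equation for that flow gives a potential
  \<open>f\<close>, and its drop across \<open>e\<close> is the effective resistance
  \<open>R\<close>. The last two claims say that \<open>R\<close> is an upper bound in the
  variational problem and that \<open>f\<close> attains it; they are free of division, so a loop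
  with \<open>R = 0\<close> is included.\<close>

lemma lap_det_update:
  assumes c: "\<And>e. e \<in> E \<Longrightarrow> c e > 0" and e: "e \<in> E"
  obtains R where "R \<ge> 0" "\<And>a. lap_det V E ends (c(e := c e + a)) = lap_det V E ends c * (1 + a * R)"
    "\<And>h. gsq h (ends e) \<le> R * energy E ends c h"
    "\<exists>f. gsq f (ends e) = R\<^sup>2 \<and> energy E ends c f = R"
proof -
  let ?M = "\<lambda>y x. laplacian V E ends c (bvec x) y" and ?S = "V - {root}"
  have "det_on ?S ?M \<noteq> 0" using lap_det_pos[of c, OF c] unfolding lap_det_eq by simp
  then obtain w where w: "\<And>y. y \<in> ?S \<Longrightarrow> (\<Sum>x\<in>?S. ?M y x * w x) = unit_flow e y"
    using det_on_solve[of ?S ?M "\<lambda>y. unit_flow e y"] fin_V by auto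
  define f where "f = expand w"
  define R where "R = f (src e) - f (tgt e)"
  \<comment> \<open>The choice of \<open>w\<close> gives the equation off the root; it extends to
    the root because both sides have total 0.\<close>
  have Lf: "laplacian V E ends c f y = unit_flow e y" if "y \<in> V" for y
    by (rule zero_sum_ext[where f = "laplacian V E ends c f" and g = "unit_flow e", OF _ _ that])
       (use w sum_unit_flow[OF e, of "\<lambda>_. 1"] in
         \<open>simp_all add: laplacian_expand f_def[symmetric] sum_laplacian_zero\<close>)
  have hL: "(\<Sum>z\<in>V. h z * laplacian V E ends c f z) = h (src e) - h (tgt e)" for h
    using sum_unit_flow[OF e, of h] by (simp add: Lf cong: sum.cong)
  have Q: "energy E ends c f = R" using hL[of f] sum_laplacian_self R_def by simp
  show ?thesis
  proof
    show "R \<ge> 0" using energy_nonneg[of c f, OF c] Q by simp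
    show "\<exists>f. gsq f (ends e) = R\<^sup>2 \<and> energy E ends c f = R"
      using Q gsq_ends[OF e, of f] R_def by (intro exI[of _ f]) simp
    show "gsq h (ends e) \<le> R * energy E ends c h" for h
      using energy_cauchy_schwarz[of c h f, OF c] unfolding hL Q gsq_ends[OF e] by (simp add: mult.commute)
    fix a
    have "laplacian V E ends (c(e := c e + a)) h y =
        laplacian V E ends c h y + a * unit_flow e y * (h (src e) - h (tgt e))" for h y
    proof -
      have "laplacian V E ends (c(e := c e + a)) h y = (\<Sum>e'\<in>E. c e' * (h (src e') - h (tgt e')) * unit_flow e' y
          + (if e' = e then a * unit_flow e y * (h (src e) - h (tgt e)) else 0))"
        unfolding laplacian_eq by (intro sum.cong refl) (simp add: algebra_simps)
      then show ?thesis using e fin_E by (simp add: sum.distrib laplacian_eq)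
    qed
    then have "lap_det V E ends (c(e := c e + a)) =
        det_on ?S (\<lambda>y x. ?M y x + a * unit_flow e y * (bvec x (src e) - bvec x (tgt e)))"
      unfolding lap_det_eq by simp
    also have "\<dots> = det_on ?S ?M * (1 + a * (\<Sum>x\<in>?S. (bvec x (src e) - bvec x (tgt e)) * w x))"
      by (rule det_on_rank1) (use w fin_V in auto)
    also have "(\<Sum>x\<in>?S. (bvec x (src e) - bvec x (tgt e)) * w x) = R"
      unfolding R_def f_def expand_def sum_subtractf[symmetric]
      by (intro sum.cong refl) (simp add: algebra_simps)
    finally show "lap_det V E ends (c(e := c e + a)) = lap_det V E ends c * (1 + a * R)"
      unfolding lap_det_eq .
  qed
qed

text \<open>The exponent is the dimension of the space of zero-sum functions.\<close>

lemma lap_det_smult: "lap_det V E ends (\<lambda>e. k * c e) = k ^ (card V - 1) * lap_det V E ends c"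
proof -
  have "laplacian V E ends (\<lambda>e. k * c e) f y = k * laplacian V E ends c f y" for f y
    unfolding laplacian_def sum_distrib_left by (simp add: mult_ac)
  then have "lap_det V E ends (\<lambda>e. k * c e) = k ^ card (V - {root}) * lap_det V E ends c"
    unfolding lap_det_eq using det_on_smult[of "V - {root}" k] by presburger
  then show ?thesis using fin_V root_in by (simp add: card_Diff_singleton)
qed

end

lemma lap_det_cong:
  assumes "\<And>e. e \<in> E \<Longrightarrow> c e = c' e" "\<And>e. e \<in> E \<Longrightarrow> ends e = ends' e"
  shows "lap_det V E ends c = lap_det V E ends' c'"
proof -
  have "laplacian V E ends c = laplacian V E ends' c'"
    unfolding laplacian_def fun_eq_iff using assms by (auto intro!: sum.cong)
  then show ?thesis unfolding lap_det_def by simp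
qed

lemma lap_det_relabel:
  assumes "inj_on \<psi> E"
  shows "lap_det V (\<psi> ` E) ends c = lap_det V E (\<lambda>e. ends (\<psi> e)) (\<lambda>e. c (\<psi> e))"
proof -
  have "laplacian V (\<psi> ` E) ends c f x = laplacian V E (\<lambda>e. ends (\<psi> e)) (\<lambda>e. c (\<psi> e)) f x" for f x
  proof -
    have "{e \<in> \<psi> ` E. x \<in> ends e} = \<psi> ` {e \<in> E. x \<in> ends (\<psi> e)}" by auto
    moreover have "inj_on \<psi> {e \<in> E. x \<in> ends (\<psi> e)}" by (rule inj_on_subset[OF assms]) auto
    ultimately show ?thesis unfolding laplacian_def by (simp add: sum.reindex)
  qed
  then show ?thesis unfolding lap_det_def by presburger
qed

text \<open>Dirichlet's principle: the optimal potential on the second graph is pulled back along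
  \<open>\<phi>\<close> to a competitor on the first one.\<close>
lemma lap_det_ratio_antimono:
  assumes A: "cgraph VA EA endsA" and B: "cgraph VB EB endsB"
    and c: "\<And>e. e \<in> EA \<Longrightarrow> cA e > 0" "\<And>e. e \<in> EB \<Longrightarrow> cB e > 0"
    and le: "\<And>e. e \<in> EA \<inter> EB \<Longrightarrow> cA e \<le> cB e"
    and comm: "\<And>e. e \<in> EA \<inter> EB \<Longrightarrow> endsB e = \<phi> ` endsA e"
    and contr: "\<And>e. e \<in> EA - EB \<Longrightarrow> \<exists>z. \<phi> ` endsA e = {z}"
    and e: "e \<in> EA \<inter> EB" and a: "a \<ge> 0"
  shows "lap_det VB EB endsB (cB(e := cB e + a)) * lap_det VA EA endsA cA
       \<le> lap_det VA EA endsA (cA(e := cA e + a)) * lap_det VB EB endsB cB"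
proof -
  interpret A: cgraph VA EA endsA by fact
  interpret B: cgraph VB EB endsB by fact
  have eA: "e \<in> EA" using e by simp
  obtain RA where RA: "RA \<ge> 0"
    "\<And>a. lap_det VA EA endsA (cA(e := cA e + a)) = lap_det VA EA endsA cA * (1 + a * RA)"
    "\<And>h. gsq h (endsA e) \<le> RA * energy EA endsA cA h"
    "\<exists>f. gsq f (endsA e) = RA\<^sup>2 \<and> energy EA endsA cA f = RA"
    by (rule A.lap_det_update[of cA e, OF c(1) eA]) (assumption, rule that)
  have eB: "e \<in> EB" using e by simp
  obtain RB where RB: "RB \<ge> 0"
    "\<And>a. lap_det VB EB endsB (cB(e := cB e + a)) = lap_det VB EB endsB cB * (1 + a * RB)"
    "\<And>h. gsq h (endsB e) \<le> RB * energy EB endsB cB h"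
    "\<exists>f. gsq f (endsB e) = RB\<^sup>2 \<and> energy EB endsB cB f = RB"
    by (rule B.lap_det_update[of cB e, OF c(2) eB]) (assumption, rule that)
  obtain f where f: "gsq f (endsB e) = RB\<^sup>2" "energy EB endsB cB f = RB"
    using RB(4) by (elim exE conjE) (rule that)
  let ?g = "\<lambda>x. f (\<phi> x)"
  \<comment> \<open>Edges present only in the first graph are contracted by \<open>\<phi>\<close>,
    so the pulled back potential does not vary along them.\<close>
  have "energy EA endsA cA ?g = (\<Sum>e\<in>EA \<inter> EB. cA e * gsq f (endsB e))"
  proof -
    have "gsq ?g (endsA e') = 0" if "e' \<in> EA - EB" for e'
    proof -
      from contr[OF that] obtain z where "\<phi> ` endsA e' = {z}" by blast
      then have "gsq ?g (endsA e') = gsq f {z}" by (simp add: gsq_image[symmetric])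
      then show ?thesis by (simp add: gsq_def)
    qed
    then show ?thesis unfolding energy_def
      by (intro sum.mono_neutral_cong_right) (auto simp: A.fin_E comm gsq_image)
  qed
  also have "\<dots> \<le> (\<Sum>e\<in>EA \<inter> EB. cB e * gsq f (endsB e))"
    by (intro sum_mono mult_right_mono le gsq_nonneg)
  also have "\<dots> \<le> energy EB endsB cB f"
    unfolding energy_def using c(2)
    by (intro sum_mono2) (auto simp: B.fin_E gsq_nonneg less_imp_le)
  finally have en: "energy EA endsA cA ?g \<le> RB" using f(2) by simp
  have "RB\<^sup>2 = gsq ?g (endsA e)" using f(1) comm[OF e] by (simp add: gsq_image)
  also have "\<dots> \<le> RA * energy EA endsA cA ?g" by (rule RA(3))
  also have "\<dots> \<le> RA * RB" by (intro mult_left_mono en RA)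
  finally have "RB * RB \<le> RA * RB" by (simp add: power2_eq_square)
  \<comment> \<open>Cancels one factor \<open>RB\<close>; the case \<open>RB = 0\<close>, which
    occurs for loops, is immediate.\<close>
  with RA(1) RB(1) have "RB \<le> RA" by (cases "RB = 0") auto
  then have "lap_det VB EB endsB cB * lap_det VA EA endsA cA * (1 + a * RB)
      \<le> lap_det VB EB endsB cB * lap_det VA EA endsA cA * (1 + a * RA)"
    using A.lap_det_pos[of cA, OF c(1)] B.lap_det_pos[of cB, OF c(2)] a
    by (intro mult_left_mono) (auto intro: mult_left_mono simp: less_imp_le)
  then show ?thesis unfolding RA(2) RB(2) by (simp add: mult_ac)
qed

section \<open>Holley's inequality\<close>

text \<open>After expansion the two mixed products \<open>P\<close>, \<open>Q\<close> are each at
  most \<open>m = c1 * d0\<close>, and their product is at most \<open>m * (c0 * d1)\<close>. This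
  suffices for \<open>P + Q \<le> m + c0 * d1\<close>.\<close>

lemma four_functions_single:
  fixes a0 a1 b0 b1 c0 c1 d0 d1 :: real
  assumes "a0 \<ge> 0" "a1 \<ge> 0" "b0 \<ge> 0" "b1 \<ge> 0" "c0 \<ge> 0" "c1 \<ge> 0" "d0 \<ge> 0" "d1 \<ge> 0"
    and 00: "a0 * b0 \<le> c0 * d0" and 01: "a0 * b1 \<le> c1 * d0" and 10: "a1 * b0 \<le> c1 * d0"
    and 11: "a1 * b1 \<le> c1 * d1"
  shows "(a0 + a1) * (b0 + b1) \<le> (c0 + c1) * (d0 + d1)"
proof -
  define m P Q where "m = c1 * d0" and "P = a0 * b1" and "Q = a1 * b0"
  have PQ: "P \<le> m" "Q \<le> m" "P \<ge> 0" "Q \<ge> 0" "m \<ge> 0"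
    using assms by (auto simp: m_def P_def Q_def)
  have prod: "P * Q \<le> m * (c0 * d1)"
  proof -
    have "(a0 * b0) * (a1 * b1) \<le> (c0 * d0) * (c1 * d1)"
      by (rule mult_mono[OF 00 11]) (use assms in auto)
    then show ?thesis by (simp add: m_def P_def Q_def mult_ac)
  qed
  have "P + Q \<le> m + c0 * d1"
  proof (cases "m = 0")
    case True
    then show ?thesis using PQ assms by simp
  next
    case False
    then have m: "m > 0" using PQ by simp
    \<comment> \<open>Expanding gives \<open>m * (P + Q) \<le> m * m + P * Q\<close>, to which the
      bound on \<open>P * Q\<close> is applied.\<close>
    have "0 \<le> (m - P) * (m - Q)" using PQ by (intro mult_nonneg_nonneg) auto
    then have "m * (P + Q) \<le> m * (m + c0 * d1)" using prod by (simp add: algebra_simps)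
    then show ?thesis using m by simp
  qed
  then show ?thesis using 00 11 by (simp add: m_def P_def Q_def algebra_simps)
qed

lemma sum_Pow_insert:
  assumes "finite E" "e \<notin> E"
  shows "(\<Sum>S\<in>Pow (insert e E). f S) = (\<Sum>S\<in>Pow E. f S + f (insert e S))"
proof -
  have inj: "inj_on (insert e) (Pow E)" using assms(2) by (auto simp: inj_on_def)
  have "(\<Sum>S\<in>Pow (insert e E). f S) = (\<Sum>S\<in>Pow E. f S) + (\<Sum>S\<in>insert e ` Pow E. f S)"
    unfolding Pow_insert using assms by (intro sum.union_disjoint) auto
  also have "\<dots> = (\<Sum>S\<in>Pow E. f S + f (insert e S))"
    by (simp add: sum.reindex[OF inj] sum.distrib)
  finally show ?thesis .
qed

text \<open>The Ahlswede-Daykin inequality on the lattice of subsets. Summing out the presence of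
  the edge \<open>e\<close> preserves the hypothesis by the one-element case, so induction on the
  edge set goes through.\<close>

lemma four_functions:
  fixes \<alpha> \<beta> \<gamma> \<delta> :: "'e set \<Rightarrow> real"
  assumes "finite E"
    and "\<And>S. S \<subseteq> E \<Longrightarrow> \<alpha> S \<ge> 0 \<and> \<beta> S \<ge> 0 \<and> \<gamma> S \<ge> 0 \<and> \<delta> S \<ge> 0"
    and "\<And>S T. S \<subseteq> E \<Longrightarrow> T \<subseteq> E \<Longrightarrow> \<alpha> S * \<beta> T \<le> \<gamma> (S \<union> T) * \<delta> (S \<inter> T)"
  shows "(\<Sum>S\<in>Pow E. \<alpha> S) * (\<Sum>S\<in>Pow E. \<beta> S) \<le> (\<Sum>S\<in>Pow E. \<gamma> S) * (\<Sum>S\<in>Pow E. \<delta> S)"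
  using assms
proof (induction E arbitrary: \<alpha> \<beta> \<gamma> \<delta> rule: finite_induct)
  case empty
  then show ?case by simp
next
  case (insert e E)
  note nonneg = insert.prems(1) and le = insert.prems(2)
  show ?case
    unfolding sum_Pow_insert[OF insert.hyps]
  proof (rule insert.IH)
    fix S assume S: "S \<subseteq> E"
    then have "S \<subseteq> insert e E" "insert e S \<subseteq> insert e E" by auto
    from nonneg[OF this(1)] nonneg[OF this(2)]
    show "0 \<le> \<alpha> S + \<alpha> (insert e S) \<and> 0 \<le> \<beta> S + \<beta> (insert e S) \<and>
        0 \<le> \<gamma> S + \<gamma> (insert e S) \<and> 0 \<le> \<delta> S + \<delta> (insert e S)" by simp
  next
    fix S T assume S: "S \<subseteq> E" and T: "T \<subseteq> E"
    have sub: "S \<subseteq> insert e E" "insert e S \<subseteq> insert e E" "T \<subseteq> insert e E" "insert e T \<subseteq> insert e E"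
      "S \<union> T \<subseteq> insert e E" "insert e (S \<union> T) \<subseteq> insert e E" "S \<inter> T \<subseteq> insert e E" "insert e (S \<inter> T) \<subseteq> insert e E"
      using S T by auto
    have eq: "S \<union> insert e T = insert e (S \<union> T)" "S \<inter> insert e T = S \<inter> T"
      "insert e S \<union> T = insert e (S \<union> T)" "insert e S \<inter> T = S \<inter> T"
      "insert e S \<union> insert e T = insert e (S \<union> T)" "insert e S \<inter> insert e T = insert e (S \<inter> T)"
      using S T insert.hyps(2) by auto
    show "(\<alpha> S + \<alpha> (insert e S)) * (\<beta> T + \<beta> (insert e T))
       \<le> (\<gamma> (S \<union> T) + \<gamma> (insert e (S \<union> T))) * (\<delta> (S \<inter> T) + \<delta> (insert e (S \<inter> T)))"
      using nonneg[OF sub(1)] nonneg[OF sub(2)] nonneg[OF sub(3)] nonneg[OF sub(4)]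
        nonneg[OF sub(5)] nonneg[OF sub(6)] nonneg[OF sub(7)] nonneg[OF sub(8)]
        le[OF sub(1) sub(3)] le[OF sub(1) sub(4), unfolded eq] le[OF sub(2) sub(3), unfolded eq]
        le[OF sub(2) sub(4), unfolded eq]
      by (intro four_functions_single) (simp_all only:)
  qed
qed

text \<open>Edges missing from \<^term>\<open>EA\<close> count as absent for the lower measure,
  and edges missing from \<^term>\<open>EB\<close> count as present for the upper one.\<close>
lemma holley:
  fixes wA wB f :: "'e set \<Rightarrow> real"
  assumes fin: "finite EA" "finite EB"
    and nn: "\<And>S. S \<subseteq> EA \<Longrightarrow> wA S \<ge> 0" "\<And>S. S \<subseteq> EB \<Longrightarrow> wB S \<ge> 0"
    and lat: "\<And>S T. S \<subseteq> EA \<Longrightarrow> T \<subseteq> EB \<Longrightarrow>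
      wA S * wB T \<le> wB (T \<union> (S \<inter> EB)) * wA (S \<inter> (T \<union> (EA - EB)))"
    and f: "\<And>S. S \<subseteq> EA \<inter> EB \<Longrightarrow> f S \<ge> 0" "\<And>S T. S \<subseteq> T \<Longrightarrow> T \<subseteq> EA \<inter> EB \<Longrightarrow> f S \<le> f T"
  shows "(\<Sum>S\<in>Pow EA. f (S \<inter> EB) * wA S) * (\<Sum>T\<in>Pow EB. wB T)
     \<le> (\<Sum>T\<in>Pow EB. f (T \<inter> EA) * wB T) * (\<Sum>S\<in>Pow EA. wA S)"
proof -
  let ?U = "EA \<union> EB"
  \<comment> \<open>Both measures are moved to subsets of \<open>?U\<close>. The increasing function
    \<open>f\<close> enters only \<open>\<alpha>\<close> and \<open>\<gamma>\<close>, so the four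
    sums are exactly two numerators and two normalisations.\<close>
  define \<alpha> where "\<alpha> X = (if X \<subseteq> EA then f (X \<inter> EB) * wA X else 0)" for X
  define \<beta> where "\<beta> X = (if EA - EB \<subseteq> X then wB (X \<inter> EB) else 0)" for X
  define \<gamma> where "\<gamma> X = (if EA - EB \<subseteq> X then f (X \<inter> EB \<inter> EA) * wB (X \<inter> EB) else 0)" for X
  define \<delta> where "\<delta> X = (if X \<subseteq> EA then wA X else 0)" for X
  have lower: "(\<Sum>X\<in>Pow ?U. if X \<subseteq> EA then g X else 0) = (\<Sum>S\<in>Pow EA. g S)" for g :: "'e set \<Rightarrow> real"
    using fin by (intro sum.mono_neutral_cong_right) auto
  have upper: "(\<Sum>X\<in>Pow ?U. if EA - EB \<subseteq> X then g (X \<inter> EB) else 0) = (\<Sum>S\<in>Pow EB. g S)"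
    for g :: "'e set \<Rightarrow> real"
  proof -
    have "(\<Sum>X\<in>Pow ?U. if EA - EB \<subseteq> X then g (X \<inter> EB) else 0) =
        (\<Sum>X\<in>{X\<in>Pow ?U. EA - EB \<subseteq> X}. g (X \<inter> EB))"
      by (rule sum.inter_filter[symmetric]) (use fin in auto)
    also have "\<dots> = (\<Sum>S\<in>Pow EB. g S)"
      by (rule sum.reindex_bij_witness[where i = "\<lambda>S. S \<union> (EA - EB)" and j = "\<lambda>X. X \<inter> EB"])
         (auto intro!: arg_cong[of _ _ g])
    finally show ?thesis .
  qed
  have "(\<Sum>X\<in>Pow ?U. \<alpha> X) * (\<Sum>X\<in>Pow ?U. \<beta> X) \<le> (\<Sum>X\<in>Pow ?U. \<gamma> X) * (\<Sum>X\<in>Pow ?U. \<delta> X)"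
  proof (rule four_functions)
    show "finite ?U" using fin by simp
    fix X assume "X \<subseteq> ?U"
    have "f (X \<inter> EB) \<ge> 0" if "X \<subseteq> EA" using that by (intro f) auto
    moreover have "f (X \<inter> EB \<inter> EA) \<ge> 0" by (intro f) auto
    ultimately show "\<alpha> X \<ge> 0 \<and> \<beta> X \<ge> 0 \<and> \<gamma> X \<ge> 0 \<and> \<delta> X \<ge> 0"
      using nn by (simp add: \<alpha>_def \<beta>_def \<gamma>_def \<delta>_def)
  next
    fix X Y assume "X \<subseteq> ?U" "Y \<subseteq> ?U"
    show "\<alpha> X * \<beta> Y \<le> \<gamma> (X \<union> Y) * \<delta> (X \<inter> Y)"
    proof (cases "X \<subseteq> EA \<and> EA - EB \<subseteq> Y")
      case True
      then have X: "X \<subseteq> EA" and Y: "EA - EB \<subseteq> Y" by auto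
      have e1: "(Y \<inter> EB) \<union> (X \<inter> EB) = (X \<union> Y) \<inter> EB" by auto
      have e2: "X \<inter> ((Y \<inter> EB) \<union> (EA - EB)) = X \<inter> Y" using X Y by auto
      have l: "wA X * wB (Y \<inter> EB) \<le> wB ((X \<union> Y) \<inter> EB) * wA (X \<inter> Y)"
        using lat[OF X, of "Y \<inter> EB"] unfolding e1 e2 by simp
      have "f (X \<inter> EB) * (wA X * wB (Y \<inter> EB)) \<le>
          f ((X \<union> Y) \<inter> EB \<inter> EA) * (wB ((X \<union> Y) \<inter> EB) * wA (X \<inter> Y))"
      proof (rule mult_mono[OF _ l])
        show "f (X \<inter> EB) \<le> f ((X \<union> Y) \<inter> EB \<inter> EA)" by (rule f(2)) (use X in auto)
        show "f ((X \<union> Y) \<inter> EB \<inter> EA) \<ge> 0" by (rule f(1)) auto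
        show "wA X * wB (Y \<inter> EB) \<ge> 0" using nn X by auto
      qed
      moreover have "X \<inter> Y \<subseteq> EA" "EA - EB \<subseteq> X \<union> Y" using X Y by auto
      ultimately show ?thesis using X Y by (simp add: \<alpha>_def \<beta>_def \<gamma>_def \<delta>_def mult_ac)
    next
      case False
      have n: "\<gamma> (X \<union> Y) * \<delta> (X \<inter> Y) \<ge> 0"
      proof -
        have "f ((X \<union> Y) \<inter> EB \<inter> EA) \<ge> 0" by (rule f(1)) auto
        moreover have "wA (X \<inter> Y) \<ge> 0" if "X \<inter> Y \<subseteq> EA" using that nn by auto
        moreover have "wB ((X \<union> Y) \<inter> EB) \<ge> 0" using nn by auto
        ultimately show ?thesis by (auto simp: \<gamma>_def \<delta>_def)
      qed
      have z: "\<alpha> X * \<beta> Y = 0" using False by (auto simp: \<alpha>_def \<beta>_def)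
      show ?thesis unfolding z by (rule n)
    qed
  qed
  then show ?thesis
    unfolding \<alpha>_def \<beta>_def \<gamma>_def \<delta>_def lower upper[of wB] upper[of "\<lambda>S. f (S \<inter> EA) * wB S"] .
qed

section \<open>Random conductances on finite graphs\<close>

definition conf :: "real \<Rightarrow> 'e set \<Rightarrow> 'e \<Rightarrow> real" where
  "conf q S e = (if e \<in> S then q else 1)"

text \<open>The parameter \<open>x\<close> stands for the odds \<open>p / (1 - p)\<close>.\<close>
definition gweight ::
  "real \<Rightarrow> real \<Rightarrow> 'v set \<Rightarrow> 'e set \<Rightarrow> ('e \<Rightarrow> 'v set) \<Rightarrow> 'e set \<Rightarrow> real" where
  "gweight x q V E ends S = x ^ card S * lap_det V E ends (conf q S) powr (-1/2)"

definition gmean ::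
  "real \<Rightarrow> real \<Rightarrow> 'v set \<Rightarrow> 'e set \<Rightarrow> ('e \<Rightarrow> 'v set) \<Rightarrow> ('e set \<Rightarrow> real) \<Rightarrow> real" where
  "gmean x q V E ends f =
     (\<Sum>S\<in>Pow E. f S * gweight x q V E ends S) / (\<Sum>S\<in>Pow E. gweight x q V E ends S)"

definition eprob :: "real \<Rightarrow> real \<Rightarrow> 'v set \<Rightarrow> 'e set \<Rightarrow> ('e \<Rightarrow> 'v set) \<Rightarrow> 'e \<Rightarrow> real" where
  "eprob x q V E ends e = gmean x q V E ends (\<lambda>S. if e \<in> S then 1 else 0)"

section \<open>Stochastic comparison of graphs\<close>

lemma conf_pos: "q \<ge> 1 \<Longrightarrow> conf q S e > 0"
  by (simp add: conf_def)

lemma (in cgraph) lap_det_conf_pos: "q \<ge> 1 \<Longrightarrow> lap_det V E ends (conf q S) > 0"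
  by (rule lap_det_pos) (rule conf_pos)

lemma (in cgraph) gweight_pos: "q \<ge> 1 \<Longrightarrow> x > 0 \<Longrightarrow> gweight x q V E ends S > 0"
  unfolding gweight_def using lap_det_conf_pos[of q S] by simp

lemma (in cgraph) sum_gweight_pos:
  "q \<ge> 1 \<Longrightarrow> x > 0 \<Longrightarrow> (\<Sum>S\<in>Pow E. gweight x q V E ends S) > 0"
  by (rule sum_pos) (auto simp: fin_E gweight_pos)

text \<open>Passing from the first graph to the second may glue vertices, add edges and contract
  edges, each of which can only lower resistances. The identity, the wiring of a box, and the
  inclusion or contraction belonging to a translated box are all instances.\<close>

locale graph_map = A: cgraph VA EA endsA + B: cgraph VB EB endsB
  for VA :: "'a set" and EA :: "'e set" and endsA and VB :: "'b set" and EB :: "'e set" and endsB +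
  fixes \<phi> :: "'a \<Rightarrow> 'b" and q :: real
  assumes ends_map: "\<And>e. e \<in> EA \<inter> EB \<Longrightarrow> endsB e = \<phi> ` endsA e"
    and contracted: "\<And>e. e \<in> EA - EB \<Longrightarrow> \<exists>z. \<phi> ` endsA e = {z}"
    and q: "q \<ge> 1"
begin

abbreviation "DA S \<equiv> lap_det VA EA endsA (conf q S)"
abbreviation "DB S \<equiv> lap_det VB EB endsB (conf q S)"

text \<open>The edges of \<open>U\<close> are raised from 1 to \<open>q\<close> one at a time in
  both graphs. Since \<open>S \<inter> EB \<subseteq> T\<close>, the conductances on common edges
  stay ordered throughout, so \<open>lap_det_ratio_antimono\<close> applies at each step with
  increment \<open>q - 1\<close>.\<close>

lemma det_ratio:
  assumes "finite U" "U \<subseteq> EA \<inter> EB" "U \<inter> T = {}" "U \<inter> S = {}" "S \<subseteq> EA" "T \<subseteq> EB" "S \<inter> EB \<subseteq> T"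
  shows "DB (T \<union> U) * DA S \<le> DA (S \<union> U) * DB T"
  using assms
proof (induction U rule: finite_induct)
  case empty
  then show ?case by simp
next
  case (insert e U)
  then have IH: "DB (T \<union> U) * DA S \<le> DA (S \<union> U) * DB T" by simp
  have upd: "conf q (X \<union> insert e U) = (conf q (X \<union> U))(e := conf q (X \<union> U) e + (q - 1))" if "e \<notin> X \<union> U" for X
    using that by (auto simp: conf_def fun_eq_iff)
  have e: "e \<notin> T \<union> U" "e \<notin> S \<union> U" "e \<in> EA \<inter> EB" using insert by auto
  have step: "DB (T \<union> insert e U) * DA (S \<union> U) \<le> DA (S \<union> insert e U) * DB (T \<union> U)"
    unfolding upd[OF e(1)] upd[OF e(2)]
  proof (rule lap_det_ratio_antimono[where \<phi> = \<phi>])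
    show "conf q (S \<union> U) e' \<le> conf q (T \<union> U) e'" if "e' \<in> EA \<inter> EB" for e'
      using that insert.prems q by (auto simp: conf_def)
  qed (use A.cgraph_axioms B.cgraph_axioms conf_pos[OF q] ends_map contracted e q in auto)
  have p: "DA X > 0" "DB X > 0" for X using A.lap_det_conf_pos[OF q] B.lap_det_conf_pos[OF q] by auto
  have "(DB (T \<union> insert e U) * DA (S \<union> U)) * (DB (T \<union> U) * DA S) \<le>
      (DA (S \<union> insert e U) * DB (T \<union> U)) * (DA (S \<union> U) * DB T)"
    using p by (intro mult_mono step IH) (auto simp: less_imp_le)
  then have "(DB (T \<union> U) * DA (S \<union> U)) * (DB (T \<union> insert e U) * DA S) \<le>
      (DB (T \<union> U) * DA (S \<union> U)) * (DA (S \<union> insert e U) * DB T)"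
    by (simp only: mult_ac)
  then show ?case using p by (simp add: mult_le_cancel_left_pos)
qed

text \<open>With \<open>U\<close> the common edges in \<open>S\<close> but not in \<open>T\<close>,
  the claim is that moving \<open>U\<close> from \<open>S\<close> over to \<open>T\<close> does not
  decrease the product of weights. This is \<open>det_ratio\<close>, reversed by the exponent -1/2,
  together with \<open>x \<le> x'\<close>.\<close>

lemma gweight_lattice:
  assumes x: "0 < x" "x \<le> x'" and S: "S \<subseteq> EA" and T: "T \<subseteq> EB"
  shows "gweight x q VA EA endsA S * gweight x' q VB EB endsB T \<le>
     gweight x' q VB EB endsB (T \<union> (S \<inter> EB)) * gweight x q VA EA endsA (S \<inter> (T \<union> (EA - EB)))"
proof -
  define U where "U = (S \<inter> EB) - T"
  define S' where "S' = S \<inter> (T \<union> (EA - EB))"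
  have SU: "S = S' \<union> U" "S' \<inter> U = {}" using S by (auto simp: U_def S'_def)
  have TU: "T \<union> (S \<inter> EB) = T \<union> U" "T \<inter> U = {}" by (auto simp: U_def)
  have fin: "finite U" "finite S'" "finite T"
    using finite_subset[OF S A.fin_E] finite_subset[OF T B.fin_E] by (auto simp: U_def S'_def)
  have p: "DA X > 0" "DB X > 0" for X using A.lap_det_conf_pos[OF q] B.lap_det_conf_pos[OF q] by auto
  have "DB (T \<union> U) * DA S' \<le> DA (S' \<union> U) * DB T"
    by (rule det_ratio) (use S T fin(1) in \<open>auto simp: U_def S'_def\<close>)
  then have "(DA (S' \<union> U) * DB T) powr (-1/2) \<le> (DB (T \<union> U) * DA S') powr (-1/2)"
    using p by (intro powr_mono2') auto
  then have d: "DA (S' \<union> U) powr (-1/2) * DB T powr (-1/2) \<le> DB (T \<union> U) powr (-1/2) * DA S' powr (-1/2)"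
    using p by (simp add: powr_mult less_imp_le)
  have "x ^ card U \<le> x' ^ card U" using x by (intro power_mono) auto
  then have c: "x ^ card (S' \<union> U) * x' ^ card T \<le> x' ^ card (T \<union> U) * x ^ card S'"
    using fin SU(2) TU(2) x by (simp add: card_Un_disjoint power_add mult_ac)
  have "(x ^ card (S' \<union> U) * x' ^ card T) * (DA (S' \<union> U) powr (-1/2) * DB T powr (-1/2))
    \<le> (x' ^ card (T \<union> U) * x ^ card S') * (DB (T \<union> U) powr (-1/2) * DA S' powr (-1/2))"
    using x by (intro mult_mono c d) auto
  then show ?thesis unfolding TU(1) S'_def[symmetric] unfolding gweight_def
    by (subst (1 2) SU(1)) (simp only: mult_ac)
qed

lemma gmean_le:
  assumes x: "0 < x" "x \<le> x'"
    and f: "\<And>S. S \<subseteq> EA \<inter> EB \<Longrightarrow> f S \<ge> 0" "\<And>S T. S \<subseteq> T \<Longrightarrow> T \<subseteq> EA \<inter> EB \<Longrightarrow> f S \<le> f T"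
  shows "gmean x q VA EA endsA (\<lambda>S. f (S \<inter> EB)) \<le> gmean x' q VB EB endsB (\<lambda>T. f (T \<inter> EA))"
proof -
  have x': "x' > 0" using x by simp
  have "(\<Sum>S\<in>Pow EA. f (S \<inter> EB) * gweight x q VA EA endsA S) * (\<Sum>T\<in>Pow EB. gweight x' q VB EB endsB T)
     \<le> (\<Sum>T\<in>Pow EB. f (T \<inter> EA) * gweight x' q VB EB endsB T) * (\<Sum>S\<in>Pow EA. gweight x q VA EA endsA S)"
  proof (rule holley[OF A.fin_E B.fin_E])
    show "gweight x q VA EA endsA S \<ge> 0" for S using A.gweight_pos[OF q x(1)] by (simp add: less_imp_le)
    show "gweight x' q VB EB endsB S \<ge> 0" for S using B.gweight_pos[OF q x'] by (simp add: less_imp_le)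
  qed (fact gweight_lattice[OF x] f)+
  then show ?thesis unfolding gmean_def
    using A.sum_gweight_pos[OF q x(1)] B.sum_gweight_pos[OF q x'] by (simp add: field_simps)
qed

lemma eprob_le:
  assumes "0 < x" "x \<le> x'" "e \<in> EA \<inter> EB"
  shows "eprob x q VA EA endsA e \<le> eprob x' q VB EB endsB e"
proof -
  have "gmean x q VA EA endsA (\<lambda>S. if e \<in> S \<inter> EB then 1 else 0)
      \<le> gmean x' q VB EB endsB (\<lambda>S. if e \<in> S \<inter> EA then 1 else 0)"
    by (rule gmean_le[OF assms(1,2), of "\<lambda>S. if e \<in> S then 1 else 0"]) auto
  then show ?thesis unfolding eprob_def using assms(3) by simp
qed

end

lemma (in cgraph) graph_map_id: "q \<ge> 1 \<Longrightarrow> graph_map V E ends V E ends (\<lambda>x. x) q"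
  by unfold_locales auto

lemma gmean_add: "gmean x q V E ends (\<lambda>S. f S + g S) = gmean x q V E ends f + gmean x q V E ends g"
  unfolding gmean_def by (simp add: distrib_right sum.distrib add_divide_distrib)

lemma gmean_diff: "gmean x q V E ends (\<lambda>S. f S - g S) = gmean x q V E ends f - gmean x q V E ends g"
  unfolding gmean_def by (simp add: left_diff_distrib sum_subtractf diff_divide_distrib)

lemma gmean_sum: "gmean x q V E ends (\<lambda>S. \<Sum>i\<in>I. f i S) = (\<Sum>i\<in>I. gmean x q V E ends (f i))"
  unfolding gmean_def sum_distrib_right sum_divide_distrib by (rule sum.swap)

lemma (in cgraph) gmean_const:
  assumes "q \<ge> 1" "x > 0"
  shows "gmean x q V E ends (\<lambda>_. k) = k"
  unfolding gmean_def sum_distrib_left[symmetric] using sum_gweight_pos[OF assms] by simp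

lemma gmean_cong:
  "(\<And>S. S \<subseteq> E \<Longrightarrow> f S = g S) \<Longrightarrow> gmean x q V E ends f = gmean x q V E ends g"
  unfolding gmean_def by (auto intro!: arg_cong2[where f = "(/)"] sum.cong)

lemma gmean_card:
  assumes "finite F"
  shows "gmean x q V E ends (\<lambda>S. real (card (S \<inter> F))) = (\<Sum>e\<in>F. eprob x q V E ends e)"
proof -
  have "real (card (S \<inter> F)) = (\<Sum>e\<in>F. if e \<in> S then 1 else 0)" for S
    using assms by (simp add: sum.If_cases Int_commute)
  then show ?thesis unfolding eprob_def gmean_sum[symmetric] by simp
qed

lemma (in cgraph) gmean_mono:
  assumes "q \<ge> 1" "x > 0" "\<And>S. S \<subseteq> E \<Longrightarrow> f S \<le> g S"
  shows "gmean x q V E ends f \<le> gmean x q V E ends g"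
  unfolding gmean_def using assms sum_gweight_pos[OF assms(1,2)] gweight_pos[OF assms(1,2)]
  by (intro divide_right_mono sum_mono mult_right_mono) (auto simp: less_imp_le)

lemma (in cgraph) eprob_bounds:
  assumes "q \<ge> 1" "x > 0"
  shows "0 \<le> eprob x q V E ends e" "eprob x q V E ends e \<le> 1"
  unfolding eprob_def using gmean_mono[OF assms, of "\<lambda>_. 0"] gmean_mono[OF assms, of _ "\<lambda>_. 1"]
  by (auto simp: gmean_const[OF assms])

lemma (in cgraph) eprob_mono:
  assumes "q \<ge> 1" "0 < x" "x \<le> x'" "e \<in> E"
  shows "eprob x q V E ends e \<le> eprob x' q V E ends e"
  using graph_map.eprob_le[OF graph_map_id[OF assms(1)] assms(2,3)] assms(4) by simp

section \<open>Partition functions and total edge densities\<close>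

definition partition_sum :: "real \<Rightarrow> 'v set \<Rightarrow> 'e set \<Rightarrow> ('e \<Rightarrow> 'v set) \<Rightarrow> real \<Rightarrow> real" where
  "partition_sum q V E ends x = (\<Sum>S\<in>Pow E. gweight x q V E ends S)"

text \<open>Each weight depends on \<open>x\<close> only through \<open>x ^ card S\<close>, so
  \<open>x\<close> times the logarithmic derivative is the expected number of open edges.\<close>

lemma (in cgraph) ln_partition_sum_deriv:
  assumes q: "q \<ge> 1" and x: "x > 0"
  shows "((\<lambda>x. ln (partition_sum q V E ends x)) has_real_derivative
    (\<Sum>e\<in>E. eprob x q V E ends e) / x) (at x)"
proof -
  let ?Z = "partition_sum q V E ends"
  let ?d = "\<lambda>S. lap_det V E ends (conf q S) powr (-1/2)"
  have Z: "?Z x > 0" unfolding partition_sum_def by (rule sum_gweight_pos[OF q x])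
  have "(?Z has_real_derivative (\<Sum>S\<in>Pow E. real (card S) * x ^ (card S - 1) * ?d S)) (at x)"
    unfolding partition_sum_def gweight_def by (auto intro!: derivative_eq_intros)
  also have "(\<Sum>S\<in>Pow E. real (card S) * x ^ (card S - 1) * ?d S) =
      (\<Sum>S\<in>Pow E. real (card S) * gweight x q V E ends S) / x"
    unfolding sum_divide_distrib gweight_def
  proof (intro sum.cong refl)
    fix S
    show "real (card S) * x ^ (card S - 1) * ?d S = real (card S) * (x ^ card S * ?d S) / x"
      \<comment> \<open>The case split deals with the truncated exponent \<open>card S - 1\<close>
        at the empty set.\<close>
      using x by (cases "card S") auto
  qed
  finally have "((\<lambda>x. ln (?Z x)) has_real_derivative
      (1 / ?Z x) * ((\<Sum>S\<in>Pow E. real (card S) * gweight x q V E ends S) / x)) (at x)"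
    using Z by (intro DERIV_chain2[OF DERIV_ln_divide]) auto
  also have "(1 / ?Z x) * ((\<Sum>S\<in>Pow E. real (card S) * gweight x q V E ends S) / x) =
      gmean x q V E ends (\<lambda>S. real (card (S \<inter> E))) / x"
    unfolding gmean_def partition_sum_def
    by (auto intro!: arg_cong2[where f = "(/)"] sum.cong simp: Int_absorb2)
  also have "gmean x q V E ends (\<lambda>S. real (card (S \<inter> E))) = (\<Sum>e\<in>E. eprob x q V E ends e)"
    by (rule gmean_card[OF fin_E])
  finally show ?thesis .
qed

lemma (in cgraph) lap_det_conf_full:
  "lap_det V E ends (conf q E) = q ^ (card V - 1) * lap_det V E ends (conf q {})"
proof -
  have "lap_det V E ends (conf q E) = lap_det V E ends (\<lambda>e. q * conf q {} e)"
    by (rule lap_det_cong) (auto simp: conf_def)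
  then show ?thesis by (simp only: lap_det_smult)
qed

text \<open>Both graphs carry the same edge set, as in the wiring of a box; \<open>K\<close> below
  then counts the vertices lost by gluing.\<close>

locale graph_quotient = graph_map VA E endsA VB E endsB \<phi> q
  for VA :: "'a set" and E :: "'e set" and endsA and VB :: "'b set" and endsB and \<phi> q
begin

abbreviation "K \<equiv> real (card VA) - real (card VB)"

text \<open>The ratio of the two determinants is antitone in the configuration, so it is squeezed between
  its values at the constant configurations, where homogeneity applies.\<close>
lemma det_bounds:
  assumes "S \<subseteq> E"
  shows "DB S \<le> DB {} / DA {} * DA S" "q powr (- K) * (DB {} / DA {}) * DA S \<le> DB S"
proof -
  have p: "DA X > 0" "DB X > 0" for X using A.lap_det_conf_pos[OF q] B.lap_det_conf_pos[OF q] by auto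
  have fin: "finite S" "finite (E - S)" using finite_subset[OF assms A.fin_E] A.fin_E by auto
  have "DB S * DA {} \<le> DA S * DB {}"
    using det_ratio[of S "{}" "{}"] fin assms by auto
  then show "DB S \<le> DB {} / DA {} * DA S" using p by (simp add: field_simps)
  have "DB (S \<union> (E - S)) * DA S \<le> DA (S \<union> (E - S)) * DB S"
    using assms fin by (intro det_ratio) auto
  moreover have "S \<union> (E - S) = E" using assms by auto
  ultimately have "DB E * DA S \<le> DA E * DB S" by simp
  moreover have "card VA \<ge> 1" "card VB \<ge> 1"
    using A.fin_V A.V_ne B.fin_V B.V_ne by (auto simp: Suc_le_eq card_gt_0_iff)
  then have "DA E = q powr (real (card VA) - 1) * DA {}" "DB E = q powr (real (card VB) - 1) * DB {}"
    using q A.lap_det_conf_full[of q] B.lap_det_conf_full[of q] by (auto simp: powr_realpow[symmetric] of_nat_diff)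
  moreover have "q powr (real (card VB) - 1) = q powr (- K) * q powr (real (card VA) - 1)"
    by (simp add: powr_add[symmetric])
  ultimately have "q powr (real (card VA) - 1) * (q powr (- K) * DB {} * DA S) \<le>
      q powr (real (card VA) - 1) * (DA {} * DB S)" by (simp add: mult_ac)
  then have "q powr (- K) * DB {} * DA S \<le> DA {} * DB S" using q by simp
  then show "q powr (- K) * (DB {} / DA {}) * DA S \<le> DB S" using p by (simp add: field_simps)
qed

text \<open>\<open>det_bounds\<close> raised to the power -1/2, term by term. What matters is that
  \<open>C\<close> is chosen before \<open>x\<close>: it cancels when the logarithm of the ratio is
  compared at two parameters.\<close>

lemma partition_sum_bounds:
  obtains C where "C > 0" "\<And>x. x > 0 \<Longrightarrow> C * partition_sum q VA E endsA x \<le> partition_sum q VB E endsB x"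
    "\<And>x. x > 0 \<Longrightarrow> partition_sum q VB E endsB x \<le> C * q powr (K / 2) * partition_sum q VA E endsA x"
proof
  let ?\<rho> = "DB {} / DA {}"
  let ?C = "?\<rho> powr (-1/2)"
  have p: "DA X > 0" "DB X > 0" for X using A.lap_det_conf_pos[OF q] B.lap_det_conf_pos[OF q] by auto
  then have r: "?\<rho> > 0" by simp
  show "?C > 0" using p[of "{}"] by simp
  have q0: "q > 0" using q by simp
  fix x :: real assume x: "x > 0"
  show "?C * partition_sum q VA E endsA x \<le> partition_sum q VB E endsB x"
    unfolding partition_sum_def sum_distrib_left
  proof (rule sum_mono)
    fix S assume "S \<in> Pow E"
    then have "(?\<rho> * DA S) powr (-1/2) \<le> DB S powr (-1/2)"
      using det_bounds(1) p by (intro powr_mono2') auto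
    then have "?C * DA S powr (-1/2) \<le> DB S powr (-1/2)"
      using p[of S] r by (metis less_imp_le powr_mult)
    then have "x ^ card S * (?C * DA S powr (-1/2)) \<le> x ^ card S * DB S powr (-1/2)"
      using x by (intro mult_left_mono) auto
    then show "?C * gweight x q VA E endsA S \<le> gweight x q VB E endsB S"
      unfolding gweight_def by (simp only: mult_ac)
  qed
  show "partition_sum q VB E endsB x \<le> ?C * q powr (K / 2) * partition_sum q VA E endsA x"
    unfolding partition_sum_def sum_distrib_left
  proof (rule sum_mono)
    fix S assume "S \<in> Pow E"
    then have "DB S powr (-1/2) \<le> (q powr (- K) * ?\<rho> * DA S) powr (-1/2)"
      using det_bounds(2) p r q0 by (intro powr_mono2') auto
    also have "\<dots> = (q powr (- K)) powr (-1/2) * ?C * DA S powr (-1/2)"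
      using p[of S] r q0 by (simp only: powr_mult)
    also have "(q powr (- K)) powr (-1/2) = q powr (K / 2)"
      unfolding powr_powr by (rule arg_cong[of _ _ "(powr) q"]) (simp add: field_simps)
    finally have "x ^ card S * DB S powr (-1/2) \<le> x ^ card S * (q powr (K / 2) * ?C * DA S powr (-1/2))"
      using x by (intro mult_left_mono) auto
    then show "gweight x q VB E endsB S \<le> ?C * q powr (K / 2) * gweight x q VA E endsA S"
      unfolding gweight_def by (simp only: mult_ac)
  qed
qed

text \<open>The mean value theorem applied to the logarithm of the ratio of the partition functions gives
  an intermediate parameter at which the total edge densities are close.\<close>
lemma eprob_gap:
  assumes ab: "0 < a" "a < b" and T: "T \<subseteq> E"
  shows "(\<Sum>e\<in>T. eprob a q VB E endsB e - eprob b q VA E endsA e) \<le> b * K * ln q / (2 * (b - a))"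
proof -
  let ?A = "\<lambda>x. eprob x q VA E endsA" and ?B = "\<lambda>x. eprob x q VB E endsB"
  let ?ZA = "partition_sum q VA E endsA" and ?ZB = "partition_sum q VB E endsB"
  obtain C where C: "C > 0" "\<And>x. x > 0 \<Longrightarrow> C * ?ZA x \<le> ?ZB x"
    "\<And>x. x > 0 \<Longrightarrow> ?ZB x \<le> C * q powr (K / 2) * ?ZA x"
    by (rule partition_sum_bounds) (rule that)
  have q0: "q > 0" using q by simp
  have Zp: "?ZA x > 0" "?ZB x > 0" if "x > 0" for x
    unfolding partition_sum_def using A.sum_gweight_pos[OF q that] B.sum_gweight_pos[OF q that] by auto
  define g where "g x = ln (?ZB x) - ln (?ZA x)" for x
  have g1: "ln C \<le> g x" if x: "x > 0" for x
  proof -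
    have "ln (C * ?ZA x) \<le> ln (?ZB x)" using C(1) C(2)[OF x] Zp[OF x] by (subst ln_le_cancel_iff) auto
    then show ?thesis using C(1) Zp[OF x] by (simp add: g_def ln_mult)
  qed
  have g2: "g x \<le> ln C + K / 2 * ln q" if x: "x > 0" for x
  proof -
    have "ln (?ZB x) \<le> ln (C * q powr (K / 2) * ?ZA x)"
      using C(1) C(3)[OF x] Zp[OF x] q0 by (subst ln_le_cancel_iff) auto
    also have "\<dots> = ln C + K / 2 * ln q + ln (?ZA x)"
      using C(1) Zp[OF x] q0 by (simp add: ln_mult ln_powr)
    finally show ?thesis by (simp add: g_def)
  qed
  have "\<exists>z>a. z < b \<and> g b - g a = (b - a) * ((\<Sum>e\<in>E. ?B z e) / z - (\<Sum>e\<in>E. ?A z e) / z)"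
  proof (rule MVT2[OF ab(2)])
    fix x assume "a \<le> x" "x \<le> b"
    then have x: "x > 0" using ab by simp
    show "(g has_real_derivative (\<Sum>e\<in>E. ?B x e) / x - (\<Sum>e\<in>E. ?A x e) / x) (at x)"
      unfolding g_def by (intro DERIV_diff A.ln_partition_sum_deriv B.ln_partition_sum_deriv q x)
  qed
  then obtain z where z: "a < z" "z < b"
    "g b - g a = (b - a) * ((\<Sum>e\<in>E. ?B z e) / z - (\<Sum>e\<in>E. ?A z e) / z)" by blast
  have z0: "z > 0" and b0: "b > 0" using ab z by auto
  have le: "?A z e \<le> ?B z e" if "e \<in> E" for e using eprob_le[of z z e] that z0 by simp
  \<comment> \<open>The point \<open>z\<close> is not under control; lowering the wired parameter to
    \<open>a\<close> and raising the free one to \<open>b\<close> only decreases the difference and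
    removes \<open>z\<close> from the left side.\<close>
  have "(\<Sum>e\<in>T. ?B a e - ?A b e) \<le> (\<Sum>e\<in>T. ?B z e - ?A z e)"
    using T ab z z0 by (intro sum_mono diff_mono A.eprob_mono B.eprob_mono q) auto
  also have "\<dots> \<le> (\<Sum>e\<in>E. ?B z e - ?A z e)"
    using le by (intro sum_mono2 A.fin_E T) auto
  finally have 1: "(\<Sum>e\<in>T. ?B a e - ?A b e) \<le> (\<Sum>e\<in>E. ?B z e - ?A z e)" .
  have 2: "(\<Sum>e\<in>E. ?B z e - ?A z e) \<ge> 0" using le by (intro sum_nonneg) auto
  have "(b - a) * ((\<Sum>e\<in>E. ?B z e - ?A z e) / z) = g b - g a"
    unfolding z(3) by (simp add: sum_subtractf diff_divide_distrib)
  also have "\<dots> \<le> K / 2 * ln q" using g1[OF ab(1)] g2[OF b0] by simp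
  finally have "(\<Sum>e\<in>E. ?B z e - ?A z e) / z \<le> K / 2 * ln q / (b - a)"
    using ab by (simp add: field_simps)
  \<comment> \<open>The total gap is nonnegative, so the unknown denominator \<open>z\<close> may be
    enlarged to \<open>b\<close>.\<close>
  moreover have "(\<Sum>e\<in>E. ?B z e - ?A z e) / b \<le> (\<Sum>e\<in>E. ?B z e - ?A z e) / z"
    using 2 z z0 b0 by (intro divide_left_mono) auto
  ultimately have "(\<Sum>e\<in>E. ?B z e - ?A z e) / b \<le> K / 2 * ln q / (b - a)" by simp
  then have "(\<Sum>e\<in>E. ?B z e - ?A z e) \<le> b * (K / 2 * ln q / (b - a))"
    using b0 by (simp add: field_simps)
  with 1 show ?thesis by simp
qed

text \<open>Adding the number of open edges in \<^term>\<open>F\<close> makes the indicator of any cylinder event on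
  \<^term>\<open>F\<close>, and also its negative, increasing.\<close>
lemma gmean_cylinder_diff:
  assumes x: "x > 0" and F: "F \<subseteq> E"
  shows "\<bar>gmean x q VB E endsB (\<lambda>S. if S \<inter> F = X then 1 else 0) -
      gmean x q VA E endsA (\<lambda>S. if S \<inter> F = X then 1 else 0)\<bar>
    \<le> (\<Sum>e\<in>F. eprob x q VB E endsB e - eprob x q VA E endsA e)"
proof -
  let ?i = "\<lambda>S. if S \<inter> F = X then 1 else (0::real)" and ?c = "\<lambda>S. real (card (S \<inter> F))"
  let ?A = "gmean x q VA E endsA" and ?B = "gmean x q VB E endsB"
  have finF: "finite F" using finite_subset[OF F A.fin_E] .
  \<comment> \<open>Either the indicator does not change, or \<open>?c\<close> grows by at least 1,
    which absorbs any jump of the indicator.\<close>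
  have step: "S \<inter> F = T \<inter> F \<or> ?c S + 1 \<le> ?c T" if "S \<subseteq> T" for S T
  proof (cases "S \<inter> F = T \<inter> F")
    case False
    then have "S \<inter> F \<subset> T \<inter> F" using that by auto
    then have "card (S \<inter> F) < card (T \<inter> F)" using finF by (intro psubset_card_mono) auto
    then show ?thesis by simp
  qed simp
  have AB: "?A f \<le> ?B f" if "\<And>S. f S \<ge> 0" "\<And>S T. S \<subseteq> T \<Longrightarrow> f S \<le> f T" for f
  proof -
    have "?A (\<lambda>S. f (S \<inter> E)) \<le> ?B (\<lambda>S. f (S \<inter> E))"
      by (rule gmean_le[OF x order_refl]) (use that in auto)
    moreover have "?A (\<lambda>S. f (S \<inter> E)) = ?A f" "?B (\<lambda>S. f (S \<inter> E)) = ?B f"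
      by (auto intro!: gmean_cong simp: Int_absorb2)
    ultimately show ?thesis by simp
  qed
  have 1: "?A (\<lambda>S. ?c S + ?i S) \<le> ?B (\<lambda>S. ?c S + ?i S)"
  proof (rule AB[where f = "\<lambda>S. ?c S + ?i S"])
    fix S T :: "'e set" assume "S \<subseteq> T"
    from step[OF this] show "?c S + ?i S \<le> ?c T + ?i T"
    proof
      assume "?c S + 1 \<le> ?c T"
      moreover have "?i S \<le> 1" "0 \<le> ?i T" by simp_all
      ultimately show ?thesis by linarith
    qed simp
  qed simp
  \<comment> \<open>The added 1 keeps the function nonnegative, as the comparison requires; having
    the same mean under both measures, it drops out at the end.\<close>
  have 2: "?A (\<lambda>S. (?c S + 1) - ?i S) \<le> ?B (\<lambda>S. (?c S + 1) - ?i S)"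
  proof (rule AB[where f = "\<lambda>S. (?c S + 1) - ?i S"])
    fix S T :: "'e set" assume "S \<subseteq> T"
    from step[OF this] show "(?c S + 1) - ?i S \<le> (?c T + 1) - ?i T"
    proof
      assume "?c S + 1 \<le> ?c T"
      moreover have "0 \<le> ?i S" "?i T \<le> 1" by simp_all
      ultimately show ?thesis by linarith
    qed simp
  qed simp
  show ?thesis
    using 1 2 unfolding gmean_diff gmean_add gmean_card[OF finF] A.gmean_const[OF q x] B.gmean_const[OF q x]
    by (simp add: sum_subtractf abs_le_iff)
qed

end

section \<open>From conductance configurations to edge subsets\<close>

lemma (in cgraph) gprob_cylinder:
  assumes q: "q > 1" and p: "0 < p" "p < 1" and F: "F \<subseteq> E" and \<xi>: "\<xi> \<in> F \<rightarrow>\<^sub>E {1, q}"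
  shows "gprob V E ends p q {\<kappa>. restrict \<kappa> F = \<xi>} =
    gmean (p / (1 - p)) q V E ends (\<lambda>S. if S \<inter> F = {e\<in>F. \<xi> e = q} then 1 else 0)"
proof -
  let ?x = "p / (1 - p)" and ?h = "\<lambda>S. restrict (conf q S) E"
  \<comment> \<open>Passing from \<open>p\<close> to the odds extracts the factor
    \<open>(1 - p) ^ card E\<close>, which is common to all configurations and cancels in the
    quotient.\<close>
  have weight: "cfg_weight V E ends p q (?h S) = (1 - p) ^ card E * gweight ?x q V E ends S" if S: "S \<subseteq> E" for S
  proof -
    have fS: "finite S" using finite_subset[OF S fin_E] .
    have e1: "{e\<in>E. ?h S e = q} = S" and e2: "{e\<in>E. ?h S e = 1} = E - S"
      using S q by (auto simp: conf_def split: if_splits)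
    have "card E = card S + card (E - S)" using S fin_E fS by (simp add: card_Diff_subset card_mono)
    then have "p ^ card S * (1 - p) ^ card (E - S) = (1 - p) ^ card E * ?x ^ card S"
      using p by (simp add: power_divide power_add)
    moreover have "lap_det V E ends (?h S) = lap_det V E ends (conf q S)"
      by (rule lap_det_cong) auto
    ultimately show ?thesis unfolding cfg_weight_def e1 e2 gweight_def by simp
  qed
  \<comment> \<open>A configuration corresponds to its set of edges of conductance \<open>q\<close>;
    this needs \<open>q\<close> and 1 to be distinct.\<close>
  have bij: "(\<Sum>\<kappa>\<in>configs E q. g \<kappa>) = (\<Sum>S\<in>Pow E. g (?h S))" for g :: "_ \<Rightarrow> real"
  proof (rule sum.reindex_bij_witness[where i = ?h and j = "\<lambda>\<kappa>. {e\<in>E. \<kappa> e = q}"])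
    fix \<kappa> assume k: "\<kappa> \<in> configs E q"
    show "?h {e \<in> E. \<kappa> e = q} = \<kappa>"
      using k by (auto simp: configs_def conf_def fun_eq_iff PiE_def extensional_def)
    then show "g (?h {e \<in> E. \<kappa> e = q}) = g \<kappa>" by simp
  next
    fix S assume S: "S \<in> Pow E"
    then show "{e \<in> E. ?h S e = q} = S" using q by (auto simp: conf_def split: if_splits)
    show "?h S \<in> configs E q" by (auto simp: configs_def conf_def)
  qed auto
  have event: "restrict (?h S) F = \<xi> \<longleftrightarrow> S \<inter> F = {e\<in>F. \<xi> e = q}" for S
  proof
    assume "restrict (?h S) F = \<xi>"
    then show "S \<inter> F = {e\<in>F. \<xi> e = q}" using F q by (auto simp: conf_def split: if_splits)
  next
    assume eq: "S \<inter> F = {e\<in>F. \<xi> e = q}"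
    show "restrict (?h S) F = \<xi>"
    proof
      fix e
      show "restrict (?h S) F e = \<xi> e"
      proof (cases "e \<in> F")
        case True
        then have "\<xi> e = 1 \<or> \<xi> e = q" using \<xi> by (auto simp: PiE_def Pi_def)
        moreover have "e \<in> S \<longleftrightarrow> \<xi> e = q" using eq True by blast
        ultimately show ?thesis using True F by (auto simp: conf_def)
      next
        case False
        then show ?thesis using \<xi> by (simp add: PiE_def extensional_def)
      qed
    qed
  qed
  have fc: "finite (configs E q)" unfolding configs_def using fin_E by (intro finite_PiE) auto
  have num: "(\<Sum>\<kappa>\<in>configs E q \<inter> {\<kappa>. restrict \<kappa> F = \<xi>}. cfg_weight V E ends p q \<kappa>) =
      (1 - p) ^ card E * (\<Sum>S\<in>Pow E. (if S \<inter> F = {e\<in>F. \<xi> e = q} then 1 else 0) * gweight ?x q V E ends S)"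
  proof -
    have "(\<Sum>\<kappa>\<in>configs E q \<inter> {\<kappa>. restrict \<kappa> F = \<xi>}. cfg_weight V E ends p q \<kappa>) =
        (\<Sum>\<kappa>\<in>configs E q. if restrict \<kappa> F = \<xi> then cfg_weight V E ends p q \<kappa> else 0)"
      using sum.inter_restrict[OF fc, of "cfg_weight V E ends p q" "{\<kappa>. restrict \<kappa> F = \<xi>}"] by simp
    also have "\<dots> = (\<Sum>S\<in>Pow E. if restrict (?h S) F = \<xi> then cfg_weight V E ends p q (?h S) else 0)"
      by (rule bij)
    also have "\<dots> = (\<Sum>S\<in>Pow E. (1 - p) ^ card E *
        ((if S \<inter> F = {e\<in>F. \<xi> e = q} then 1 else 0) * gweight ?x q V E ends S))"
      unfolding event by (intro sum.cong refl) (simp add: weight)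
    finally show ?thesis by (simp only: sum_distrib_left)
  qed
  have den: "(\<Sum>\<kappa>\<in>configs E q. cfg_weight V E ends p q \<kappa>) =
      (1 - p) ^ card E * (\<Sum>S\<in>Pow E. gweight ?x q V E ends S)"
    unfolding bij sum_distrib_left by (intro sum.cong refl) (simp add: weight)
  show ?thesis unfolding gprob_def num den gmean_def using p by simp
qed

text \<open>For \<open>q = 1\<close> there is a single configuration, so the measure is a point mass
  depending on the edge set alone.\<close>

lemma (in cgraph) gprob_trivial:
  assumes p: "0 < p" "p < 1"
  shows "gprob V E ends p 1 A = (if restrict (\<lambda>_. 1) E \<in> A then 1 else 0)"
proof -
  define k :: "'e \<Rightarrow> real" where "k = restrict (\<lambda>_. 1) E"
  have c: "configs E (1::real) = {k}"
    unfolding configs_def k_def by (auto simp: PiE_def extensional_def fun_eq_iff Pi_def)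
  have "lap_det V E ends k > 0" by (rule lap_det_pos) (simp add: k_def)
  then have "cfg_weight V E ends p 1 k > 0"
    unfolding cfg_weight_def using p by simp
  then show ?thesis unfolding gprob_def c k_def[symmetric] by simp
qed

lemma eprob_relabel:
  assumes inj: "inj_on \<psi> E" and e: "e \<in> E" and ends: "\<And>e. e \<in> E \<Longrightarrow> ends (\<psi> e) = ends' e"
  shows "eprob x q V (\<psi> ` E) ends (\<psi> e) = eprob x q V E ends' e"
proof -
  have w: "gweight x q V (\<psi> ` E) ends (\<psi> ` S) = gweight x q V E ends' S" if "S \<subseteq> E" for S
  proof -
    have "card (\<psi> ` S) = card S" by (rule card_image[OF inj_on_subset[OF inj that]])
    moreover have "lap_det V (\<psi> ` E) ends (conf q (\<psi> ` S)) = lap_det V E ends' (conf q S)"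
      unfolding lap_det_relabel[OF inj]
      by (rule lap_det_cong) (use that inj ends in \<open>auto simp: conf_def inj_on_image_mem_iff\<close>)
    ultimately show ?thesis by (simp add: gweight_def)
  qed
  have s: "(\<Sum>S\<in>Pow (\<psi> ` E). g S) = (\<Sum>S\<in>Pow E. g (\<psi> ` S))" for g :: "_ \<Rightarrow> real"
    unfolding image_Pow_surj[OF refl, symmetric]
    by (subst sum.reindex) (auto intro: inj_on_image_Pow inj)
  have m: "\<psi> e \<in> \<psi> ` S \<longleftrightarrow> e \<in> S" if "S \<subseteq> E" for S
    using inj_on_image_mem_iff[OF inj e that] .
  have n: "(\<Sum>S\<in>Pow E. (if \<psi> e \<in> \<psi> ` S then 1 else 0) * gweight x q V (\<psi> ` E) ends (\<psi> ` S)) =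
      (\<Sum>S\<in>Pow E. (if e \<in> S then 1 else 0) * gweight x q V E ends' S)"
    by (intro sum.cong refl) (simp add: m w)
  have d: "(\<Sum>S\<in>Pow E. gweight x q V (\<psi> ` E) ends (\<psi> ` S)) = (\<Sum>S\<in>Pow E. gweight x q V E ends' S)"
    by (intro sum.cong refl) (simp add: w)
  show ?thesis unfolding eprob_def gmean_def s n d ..
qed

section \<open>Boxes of the integer lattice\<close>

lemma box_eq_lists: "box d n = {xs. set xs \<subseteq> {- int n..int n} \<and> length xs = d}"
proof -
  have "(\<forall>i<d. \<bar>x ! i\<bar> \<le> int n) \<longleftrightarrow> set x \<subseteq> {- int n..int n}" if "length x = d" for x
    using that by (auto simp: set_conv_nth abs_le_iff subset_iff)
  then show ?thesis unfolding box_def by blast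
qed

lemma finite_box: "finite (box d n)"
  unfolding box_eq_lists by (rule finite_lists_length_eq) simp

lemma card_box: "card (box d n) = (2 * n + 1) ^ d"
proof -
  have "card {- int n..int n} = 2 * n + 1" unfolding card_atLeastAtMost_int by linarith
  then show ?thesis unfolding box_eq_lists by (subst card_lists_length_eq) simp_all
qed

lemma box_mono: "m \<le> n \<Longrightarrow> box d m \<subseteq> box d n"
  unfolding box_def by force

lemma replicate_in_box: "replicate d 0 \<in> box d n"
  by (simp add: box_def)

lemma Zd_edgeE:
  assumes "e \<in> Zd_edges d"
  obtains x y where "e = {x, y}" "adj d x y"
  using assms unfolding Zd_edges_def by blast

lemma finite_box_edges: "finite (box_edges d n)"
  by (rule finite_subset[of _ "Pow (box d n)"]) (auto simp: box_edges_def finite_box)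

lemma box_edges_mono: "m \<le> n \<Longrightarrow> box_edges d m \<subseteq> box_edges d n"
  unfolding box_edges_def using box_mono by blast

lemma in_some_box:
  assumes "length x = d"
  obtains n where "x \<in> box d n"
proof
  show "x \<in> box d (nat (\<Sum>i<d. \<bar>x ! i\<bar>))"
    unfolding box_def using assms member_le_sum[of _ "{..<d}" "\<lambda>i. \<bar>x ! i\<bar>"] by auto
qed

lemma in_some_box_edges:
  assumes "e \<in> Zd_edges d"
  obtains n where "e \<in> box_edges d n"
proof -
  from assms obtain x y where e: "e = {x, y}" "adj d x y" by (rule Zd_edgeE)
  then have "length x = d" "length y = d" by (auto simp: adj_def)
  then obtain m n where "x \<in> box d m" "y \<in> box d n" by (metis in_some_box)
  then have "e \<in> box_edges d (max m n)"
    using e assms box_mono[of m "max m n" d] box_mono[of n "max m n" d] by (auto simp: box_edges_def)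
  then show ?thesis by (rule that)
qed

text \<open>One unit step of a nonzero coordinate towards 0. Repeating it leads from any vertex to
  the origin inside the box, which gives connectedness by induction on the l1 norm.\<close>

lemma adj_decrease:
  assumes len: "length x = d" and i: "i < d" "x ! i \<noteq> 0"
  defines "x' \<equiv> x[i := x ! i - sgn (x ! i)]"
  shows "adj d x x'" "(\<Sum>j<d. nat \<bar>x' ! j\<bar>) < (\<Sum>j<d. nat \<bar>x ! j\<bar>)" "\<And>n. x \<in> box d n \<Longrightarrow> x' \<in> box d n"
proof -
  have x': "x' ! j = (if j = i then x ! i - sgn (x ! i) else x ! j)" if "j < d" for j
    using that len by (simp add: x'_def)
  have "(\<Sum>j<d. \<bar>x ! j - x' ! j\<bar>) = (\<Sum>j<d. if j = i then 1 else 0)"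
    by (intro sum.cong refl) (use i in \<open>auto simp: x' sgn_if\<close>)
  then show "adj d x x'" using i len by (simp add: adj_def x'_def)
  show "(\<Sum>j<d. nat \<bar>x' ! j\<bar>) < (\<Sum>j<d. nat \<bar>x ! j\<bar>)"
  proof (rule sum_strict_mono_ex1)
    show "\<forall>j\<in>{..<d}. nat \<bar>x' ! j\<bar> \<le> nat \<bar>x ! j\<bar>" by (auto simp: x' sgn_if)
    show "\<exists>j\<in>{..<d}. nat \<bar>x' ! j\<bar> < nat \<bar>x ! j\<bar>"
      using i by (intro bexI[of _ i]) (auto simp: x' sgn_if)
  qed simp
  show "x' \<in> box d n" if "x \<in> box d n" for n
    unfolding box_def
  proof (intro CollectI conjI allI impI)
    show "length x' = d" using len by (simp add: x'_def)
    fix j assume j: "j < d"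
    then have "\<bar>x ! j\<bar> \<le> int n" using that by (simp add: box_def)
    then show "\<bar>x' ! j\<bar> \<le> int n" using j i by (auto simp: x' sgn_if)
  qed
qed

lemma cgraph_box: "cgraph (box d n) (box_edges d n) (\<lambda>e. e)"
proof
  show "finite (box d n)" "finite (box_edges d n)" by (rule finite_box finite_box_edges)+
  show "box d n \<noteq> {}" using replicate_in_box by blast
  fix e assume "e \<in> box_edges d n"
  then show "\<exists>x\<in>box d n. \<exists>y\<in>box d n. e = {x, y}"
    unfolding box_edges_def by (auto elim!: Zd_edgeE)
next
  fix f :: "int list \<Rightarrow> real" and x y
  assume f: "\<And>e x y. e \<in> box_edges d n \<Longrightarrow> x \<in> e \<Longrightarrow> y \<in> e \<Longrightarrow> f x = f y"
  have "f x = f (replicate d 0)" if "x \<in> box d n" for x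
    using that
  proof (induction "\<Sum>j<d. nat \<bar>x ! j\<bar>" arbitrary: x rule: less_induct)
    case less
    then have len: "length x = d" by (simp add: box_def)
    show ?case
    proof (cases "\<exists>i<d. x ! i \<noteq> 0")
      case True
      then obtain i where i: "i < d" "x ! i \<noteq> 0" by blast
      define x' where "x' = x[i := x ! i - sgn (x ! i)]"
      note x' = adj_decrease[OF len i, folded x'_def]
      have "{x, x'} \<in> box_edges d n"
        using x'(1) x'(3)[OF less.prems] less.prems by (auto simp: box_edges_def Zd_edges_def)
      then have "f x = f x'" by (rule f) auto
      also have "\<dots> = f (replicate d 0)" by (rule less.hyps[OF x'(2) x'(3)[OF less.prems]])
      finally show ?thesis .
    next
      case False
      then have "x = replicate d 0" using len by (intro nth_equalityI) auto
      then show ?thesis by simp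
    qed
  qed
  then show "x \<in> box d n \<Longrightarrow> y \<in> box d n \<Longrightarrow> f x = f y" by metis
qed

lemma cgraph_quotient:
  assumes "cgraph V E ends"
  shows "cgraph (\<phi> ` V) E (\<lambda>e. \<phi> ` ends e)"
proof -
  interpret cgraph V E ends by fact
  show ?thesis
  proof
    show "finite (\<phi> ` V)" "finite E" "\<phi> ` V \<noteq> {}" using fin_V fin_E V_ne by auto
    fix e assume "e \<in> E"
    from ends_pair[OF this] obtain x y where "x \<in> V" "y \<in> V" "ends e = {x, y}" by blast
    then show "\<exists>x\<in>\<phi> ` V. \<exists>y\<in>\<phi> ` V. \<phi> ` ends e = {x, y}"
      by (intro bexI[of _ "\<phi> x"] bexI[of _ "\<phi> y"]) auto
  next
    fix f :: "_ \<Rightarrow> real" and x y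
    assume f: "\<And>e x y. e \<in> E \<Longrightarrow> x \<in> \<phi> ` ends e \<Longrightarrow> y \<in> \<phi> ` ends e \<Longrightarrow> f x = f y"
      and xy: "x \<in> \<phi> ` V" "y \<in> \<phi> ` V"
    from xy obtain u v where uv: "x = \<phi> u" "y = \<phi> v" "u \<in> V" "v \<in> V" by auto
    have "f (\<phi> u) = f (\<phi> v)"
    proof (rule connected[of "\<lambda>u. f (\<phi> u)", OF _ uv(3,4)])
      fix e x y assume "e \<in> E" "x \<in> ends e" "y \<in> ends e"
      then show "f (\<phi> x) = f (\<phi> y)" by (intro f) auto
    qed
    then show "f x = f y" using uv by simp
  qed
qed

lemma cgraph_relabel:
  assumes "cgraph V (\<psi> ` E) ends" "inj_on \<psi> E"
  shows "cgraph V E (\<lambda>e. ends (\<psi> e))"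
proof -
  interpret cgraph V "\<psi> ` E" ends by fact
  show ?thesis
  proof
    show "finite V" "finite E" "V \<noteq> {}" using fin_V fin_E V_ne finite_imageD[OF _ assms(2)] by auto
    fix e assume "e \<in> E"
    then show "\<exists>x\<in>V. \<exists>y\<in>V. ends (\<psi> e) = {x, y}" by (intro ends_pair) auto
  next
    fix f :: "_ \<Rightarrow> real" and x y
    assume f: "\<And>e x y. e \<in> E \<Longrightarrow> x \<in> ends (\<psi> e) \<Longrightarrow> y \<in> ends (\<psi> e) \<Longrightarrow> f x = f y"
      and xy: "x \<in> V" "y \<in> V"
    show "f x = f y"
      by (rule connected[OF _ xy]) (use f in blast)
  qed
qed

lemma cgraph_wbox: "cgraph (wbox d n) (box_edges d n) (\<lambda>e. wire d n ` e)"
  unfolding wbox_def by (rule cgraph_quotient[OF cgraph_box])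

lemma graph_quotient_wire:
  assumes "q \<ge> 1"
  shows "graph_quotient (box d n) (box_edges d n) (\<lambda>e. e) (wbox d n) (\<lambda>e. wire d n ` e) (wire d n) q"
  unfolding graph_quotient_def graph_map_def graph_map_axioms_def
  using cgraph_box cgraph_wbox assms by auto

abbreviation eprob_free :: "nat \<Rightarrow> real \<Rightarrow> nat \<Rightarrow> real \<Rightarrow> int list set \<Rightarrow> real" where
  "eprob_free d q n x \<equiv> eprob x q (box d n) (box_edges d n) (\<lambda>e. e)"

abbreviation eprob_wired :: "nat \<Rightarrow> real \<Rightarrow> nat \<Rightarrow> real \<Rightarrow> int list set \<Rightarrow> real" where
  "eprob_wired d q n x \<equiv> eprob x q (wbox d n) (box_edges d n) (\<lambda>e. wire d n ` e)"

section \<open>Translations and comparison of boxes\<close>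

definition shift :: "int list \<Rightarrow> int list \<Rightarrow> int list" where
  "shift z x = map2 (+) z x"

lemma length_shift [simp]: "length (shift z x) = min (length z) (length x)"
  by (simp add: shift_def)

lemma nth_shift: "i < length z \<Longrightarrow> i < length x \<Longrightarrow> shift z x ! i = z ! i + x ! i"
  by (simp add: shift_def)

lemma shift_uminus:
  assumes "length z = d" "length x = d"
  shows "shift (map uminus z) (shift z x) = x" "shift z (shift (map uminus z) x) = x"
  using assms by (auto intro!: nth_equalityI simp: nth_shift)

lemma adj_shift: "length z = d \<Longrightarrow> adj d x y \<Longrightarrow> adj d (shift z x) (shift z y)"
  unfolding adj_def by (auto simp: nth_shift)

lemma adj_commute: "adj d x y \<longleftrightarrow> adj d y x"
  unfolding adj_def by (auto simp: abs_minus_commute)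

lemma Zd_edges_length: "e \<in> Zd_edges d \<Longrightarrow> x \<in> e \<Longrightarrow> length x = d"
  by (auto elim!: Zd_edgeE simp: adj_def)

lemma Zd_edges_shift: "length z = d \<Longrightarrow> e \<in> Zd_edges d \<Longrightarrow> shift z ` e \<in> Zd_edges d"
  unfolding Zd_edges_def using adj_shift by (elim CollectE exE conjE) (simp, blast)

lemma shift_uminus_image:
  assumes "length z = d" "e \<in> Zd_edges d"
  shows "shift (map uminus z) ` shift z ` e = e" "shift z ` shift (map uminus z) ` e = e"
proof -
  have "shift (map uminus z) ` shift z ` e = (\<lambda>x. x) ` e" unfolding image_image
    by (intro image_cong refl shift_uminus(1)[OF assms(1) Zd_edges_length[OF assms(2)]])
  then show "shift (map uminus z) ` shift z ` e = e" by simp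
  have "shift z ` shift (map uminus z) ` e = (\<lambda>x. x) ` e" unfolding image_image
    by (intro image_cong refl shift_uminus(2)[OF assms(1) Zd_edges_length[OF assms(2)]])
  then show "shift z ` shift (map uminus z) ` e = e" by simp
qed

lemma shift_in_box:
  assumes "z \<in> box d k" "x \<in> box d m"
  shows "shift z x \<in> box d (k + m)"
  unfolding box_def
proof (intro CollectI conjI allI impI)
  show "length (shift z x) = d" using assms by (simp add: box_def)
  fix i assume i: "i < d"
  then have "\<bar>z ! i\<bar> \<le> int k" "\<bar>x ! i\<bar> \<le> int m" "shift z x ! i = z ! i + x ! i"
    using assms by (auto simp: box_def nth_shift)
  then show "\<bar>shift z x ! i\<bar> \<le> int (k + m)" by linarith
qed

lemma uminus_in_box: "z \<in> box d k \<Longrightarrow> map uminus z \<in> box d k"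
  by (simp add: box_def)

lemma adj_in_box:
  assumes "x \<in> box d m" "adj d x y"
  shows "y \<in> box d (m + 1)"
  unfolding box_def
proof (intro CollectI conjI allI impI)
  show "length y = d" using assms by (simp add: adj_def)
  fix i assume i: "i < d"
  have "\<bar>x ! i - y ! i\<bar> \<le> 1"
    using assms(2) member_le_sum[of i "{..<d}" "\<lambda>i. \<bar>x ! i - y ! i\<bar>"] i by (auto simp: adj_def)
  moreover have "\<bar>x ! i\<bar> \<le> int m" using assms(1) i by (simp add: box_def)
  ultimately show "\<bar>y ! i\<bar> \<le> int (m + 1)" by linarith
qed

lemma not_box_boundary: "x \<in> box d m \<Longrightarrow> m < n \<Longrightarrow> x \<notin> box_boundary d n"
  unfolding box_boundary_def using adj_in_box box_mono[of "m + 1" n d] by fastforce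

text \<open>For the wired part, the large wired box is mapped to the small one by contracting everything
  outside the interior of the translated small box.\<close>
lemma eprob_translate:
  assumes q: "q \<ge> 1" and x: "x > 0" and z: "z \<in> box d k" and M: "M > n + k"
    and e: "e \<in> Zd_edges d" "shift z ` e \<in> box_edges d n"
  shows "eprob_free d q n x (shift z ` e) \<le> eprob_free d q M x e" (is ?free)
    and "eprob_wired d q M x e \<le> eprob_wired d q n x (shift z ` e)" (is ?wired)
proof -
  let ?\<psi> = "\<lambda>e. shift z ` e" and ?z' = "map uminus z"
  \<comment> \<open>The edges whose translates lie in the small box. The small box is relabelled by
    them so that both graphs have edges of the same lattice as labels, matched by the
    translation.\<close>
  define E' where "E' = {e \<in> Zd_edges d. shift z ` e \<subseteq> box d n}"
  have lz: "length z = d" "length ?z' = d" using z by (auto simp: box_def)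
  have inj: "inj_on ?\<psi> E'"
    by (rule inj_on_inverseI[where g = "\<lambda>e. shift ?z' ` e"])
       (simp add: E'_def shift_uminus_image(1)[OF lz(1)])
  have im: "?\<psi> ` E' = box_edges d n"
  proof
    show "?\<psi> ` E' \<subseteq> box_edges d n" using Zd_edges_shift[OF lz(1)] by (auto simp: E'_def box_edges_def)
    show "box_edges d n \<subseteq> ?\<psi> ` E'"
    proof
      fix e' assume e': "e' \<in> box_edges d n"
      then have "e' = ?\<psi> (shift ?z' ` e')" "shift ?z' ` e' \<in> Zd_edges d"
        using shift_uminus_image(2)[OF lz(1)] Zd_edges_shift[OF lz(2)] by (auto simp: box_edges_def)
      moreover have "shift ?z' ` e' \<in> E'"
        using calculation e' by (simp add: E'_def box_edges_def)
      ultimately show "e' \<in> ?\<psi> ` E'" by blast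
    qed
  qed
  have unshift: "y \<in> box d (n + k)" if "length y = d" "shift z y \<in> box d n" for y
    using shift_in_box[OF uminus_in_box[OF z] that(2)] shift_uminus(1)[OF lz(1) that(1)] by (simp add: add.commute)
  have E'M: "E' \<subseteq> box_edges d M"
  proof
    fix e assume "e \<in> E'"
    then have e: "e \<in> Zd_edges d" "\<And>y. y \<in> e \<Longrightarrow> shift z y \<in> box d n" by (auto simp: E'_def)
    then have "y \<in> box d M" if "y \<in> e" for y
      using unshift[OF Zd_edges_length[OF e(1) that] e(2)[OF that]] box_mono[of "n + k" M d] M by auto
    then show "e \<in> box_edges d M" using e by (auto simp: box_edges_def)
  qed
  have eE': "e \<in> E'" using e by (auto simp: E'_def box_edges_def)
  then have eM: "e \<in> box_edges d M" using E'M by auto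
  have "cgraph (box d n) E' ?\<psi>"
    using cgraph_relabel[of "box d n" ?\<psi> E' "\<lambda>e. e"] cgraph_box[of d n] inj im by simp
  \<comment> \<open>The small graph keeps its vertices but has shifted endpoints, so shifting back
    by \<open>?z'\<close> embeds it into the large box.\<close>
  then have "graph_map (box d n) E' ?\<psi> (box d M) (box_edges d M) (\<lambda>e. e) (shift ?z') q"
    unfolding graph_map_def graph_map_axioms_def
    using cgraph_box q E'M by (auto simp: E'_def shift_uminus_image(1)[OF lz(1)])
  from graph_map.eprob_le[OF this x order_refl, of e] eE' eM
  show ?free using eprob_relabel[OF inj eE', of "\<lambda>e. e" ?\<psi> x q "box d n"] by (simp add: im)
  define \<phi> where "\<phi> u = (case u of None \<Rightarrow> None | Some y \<Rightarrow>
      if shift z y \<in> box d n then wire d n (shift z y) else None)" for u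
  have "cgraph (wbox d n) E' (\<lambda>e. wire d n ` ?\<psi> e)"
    using cgraph_relabel[of "wbox d n" ?\<psi> E' "\<lambda>e. wire d n ` e"] cgraph_wbox[of d n] inj im by simp
  moreover have "wire d n ` ?\<psi> e' = \<phi> ` wire d M ` e'" if e': "e' \<in> E'" for e'
  proof -
    have "wire d n (shift z y) = \<phi> (wire d M y)" if "y \<in> e'" for y
    proof -
      have y: "shift z y \<in> box d n" "length y = d" using e' that Zd_edges_length by (auto simp: E'_def)
      have "y \<notin> box_boundary d M" by (rule not_box_boundary[OF unshift[OF y(2,1)] M])
      then show ?thesis using y by (simp add: \<phi>_def wire_def)
    qed
    then show ?thesis unfolding image_image by (intro image_cong refl)
  qed
  moreover have "\<exists>u. \<phi> ` wire d M ` e' = {u}" if e': "e' \<in> box_edges d M - E'" for e'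
  proof -
    from e' have Z: "e' \<in> Zd_edges d" and nE: "e' \<notin> E'" by (auto simp: box_edges_def)
    from Z obtain a b where ab: "e' = {a, b}" "adj d a b" by (rule Zd_edgeE)
    \<comment> \<open>An endpoint that is wired in the large box or whose translate is outside the
      small one is sent to \<open>None\<close> at once. Otherwise its partner's translate must lie
      outside, so its own translate is a boundary vertex and is wired.\<close>
    have None: "\<phi> (wire d M y) = None" if "y \<in> e'" for y
    proof (cases "wire d M y = Some y \<and> shift z y \<in> box d n")
      case True
      obtain y' where y': "adj d y y'" "e' = {y, y'}" using ab \<open>y \<in> e'\<close> adj_commute by auto
      have "shift z y' \<notin> box d n" using nE Z y' True by (auto simp: E'_def)
      then have "shift z y \<in> box_boundary d n"
        using True adj_shift[OF lz(1) y'(1)] by (auto simp: box_boundary_def)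
      then show ?thesis using True by (simp add: \<phi>_def wire_def)
    next
      case False
      then show ?thesis by (auto simp: \<phi>_def wire_def)
    qed
    have "\<phi> ` wire d M ` e' = {None}" using None ab(1) by auto
    then show ?thesis by blast
  qed
  ultimately have "graph_map (wbox d M) (box_edges d M) (\<lambda>e. wire d M ` e) (wbox d n) E' (\<lambda>e. wire d n ` ?\<psi> e) \<phi> q"
    unfolding graph_map_def graph_map_axioms_def using cgraph_wbox q by auto
  from graph_map.eprob_le[OF this x order_refl, of e] eE' eM
  show ?wired using eprob_relabel[OF inj eE', of "\<lambda>e. wire d n ` e" "\<lambda>e. wire d n ` ?\<psi> e" x q "wbox d n"]
    by (simp add: im)
qed

section \<open>Averaging over translates\<close>

lemma inj_on_shift_edge:
  assumes "e \<in> Zd_edges d"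
  shows "inj_on (\<lambda>z. shift z ` e) (box d k)"
proof (rule inj_onI)
  fix z z' assume z: "z \<in> box d k" "z' \<in> box d k" and eq: "shift z ` e = shift z' ` e"
  from assms obtain x y where e: "e = {x, y}" "adj d x y" by (rule Zd_edgeE)
  then have len: "length x = d" "length y = d" "length z = d" "length z' = d"
    using z by (auto simp: adj_def box_def)
  from eq have "(shift z x = shift z' x \<and> shift z y = shift z' y) \<or> (shift z x = shift z' y \<and> shift z y = shift z' x)"
    unfolding e by (auto simp: doubleton_eq_iff)
  then have "z ! i = z' ! i" if i: "i < d" for i
  proof
    assume "shift z x = shift z' x \<and> shift z y = shift z' y"
    then have "shift z x ! i = shift z' x ! i" by simp
    then show ?thesis using i len by (simp add: nth_shift)
  next
    \<comment> \<open>Adding the two equations cancels \<open>x\<close> and \<open>y\<close> and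
      leaves twice the translation vectors.\<close>
    assume "shift z x = shift z' y \<and> shift z y = shift z' x"
    then have "shift z x ! i = shift z' y ! i" "shift z y ! i = shift z' x ! i" by auto
    then show ?thesis using i len by (simp add: nth_shift)
  qed
  then show "z = z'" using len by (intro nth_equalityI) auto
qed

text \<open>Vertices of the next smaller box are not on the boundary and survive wiring as distinct
  points, so gluing loses at most a surface layer.\<close>

lemma card_wbox_ge:
  assumes "n \<ge> 1"
  shows "(2 * n - 1) ^ d \<le> card (wbox d n)"
proof -
  have "Some ` box d (n - 1) \<subseteq> wbox d n"
  proof
    fix u assume "u \<in> Some ` box d (n - 1)"
    then obtain x where x: "u = Some x" "x \<in> box d (n - 1)" by auto
    have "x \<notin> box_boundary d n" using not_box_boundary[OF x(2)] assms by simp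
    then have "u = wire d n x" using x by (simp add: wire_def)
    moreover have "x \<in> box d n" using x box_mono[of "n - 1" n d] by auto
    ultimately show "u \<in> wbox d n" unfolding wbox_def by blast
  qed
  then have "card (Some ` box d (n - 1)) \<le> card (wbox d n)"
    by (intro card_mono) (auto simp: wbox_def finite_box)
  moreover have "card (Some ` box d (n - 1)) = (2 * (n - 1) + 1) ^ d"
    by (simp add: card_image card_box)
  moreover have "2 * (n - 1) + 1 = 2 * n - 1" using assms by simp
  ultimately show ?thesis by simp
qed

text \<open>The gap at \<open>e\<close> in the large box is at most the gap at each of the
  \<open>(2 * j + 1) ^ d\<close> distinct translates of \<open>e\<close> in the box of radius
  \<open>m + j\<close>. Their total is bounded by \<open>eprob_gap\<close>, and the right side is
  that bound divided by the number of translates.\<close>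

lemma eprob_gap_box:
  assumes q: "q \<ge> 1" and ab: "0 < a" "a < b" and e: "e \<in> box_edges d m" and j: "j \<ge> 1"
    and M: "M > m + 2 * j"
  shows "eprob_wired d q M a e - eprob_free d q M b e
    \<le> ((1 + 2 * real m / (2 * real j + 1)) ^ d - (1 + (2 * real m - 2) / (2 * real j + 1)) ^ d) *
       (b * ln q / (2 * (b - a)))"
proof -
  let ?n = "m + j" and ?s = "eprob_wired d q M a e - eprob_free d q M b e"
  define T where "T = (\<lambda>z. shift z ` e) ` box d j"
  have eZ: "e \<in> Zd_edges d" "e \<subseteq> box d m" using e by (auto simp: box_edges_def)
  have b: "b > 0" using ab by simp
  have lz: "length z = d" if "z \<in> box d j" for z using that by (simp add: box_def)
  have T: "T \<subseteq> box_edges d ?n"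
    unfolding T_def box_edges_def using Zd_edges_shift[OF lz eZ(1)] shift_in_box eZ(2)
    by (fastforce simp: add.commute)
  have cardT: "card T = (2 * j + 1) ^ d"
    unfolding T_def by (simp add: card_image[OF inj_on_shift_edge[OF eZ(1)]] card_box)
  interpret graph_quotient "box d ?n" "box_edges d ?n" "\<lambda>e. e" "wbox d ?n" "\<lambda>e. wire d ?n ` e" "wire d ?n" q
    by (rule graph_quotient_wire[OF q])
  have "real (card T) * ?s = (\<Sum>e'\<in>T. ?s)" by simp
  also have "\<dots> \<le> (\<Sum>e'\<in>T. eprob_wired d q ?n a e' - eprob_free d q ?n b e')"
  proof (rule sum_mono)
    fix e' assume "e' \<in> T"
    then obtain z where z: "z \<in> box d j" "e' = shift z ` e" unfolding T_def by auto
    \<comment> \<open>This is where \<open>m + 2 * j\<close> comes from: radius \<open>m + j\<close>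
      for the small box plus \<open>j\<close> for the translation.\<close>
    have M': "M > ?n + j" using M by simp
    have e': "shift z ` e \<in> box_edges d ?n" using z T by (auto simp: T_def)
    show "?s \<le> eprob_wired d q ?n a e' - eprob_free d q ?n b e'"
      unfolding z(2)
      by (rule diff_mono eprob_translate(2)[OF q ab(1) z(1) M' eZ(1) e']
          eprob_translate(1)[OF q b z(1) M' eZ(1) e'])+
  qed
  also have "\<dots> \<le> b * K * ln q / (2 * (b - a))"
    by (rule eprob_gap[OF ab T])
  also have "\<dots> = K * (b * ln q / (2 * (b - a)))" by simp
  also have "\<dots> \<le> (real (2 * ?n + 1) ^ d - real (2 * ?n - 1) ^ d) * (b * ln q / (2 * (b - a)))"
  proof (rule mult_right_mono)
    have "real ((2 * ?n - 1) ^ d) \<le> real (card (wbox d ?n))"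
      using card_wbox_ge[of ?n d] j by (intro of_nat_mono) simp
    then show "K \<le> real (2 * ?n + 1) ^ d - real (2 * ?n - 1) ^ d"
      unfolding card_box of_nat_power by linarith
    show "0 \<le> b * ln q / (2 * (b - a))" using ab q by (intro divide_nonneg_pos mult_nonneg_nonneg) auto
  qed
  finally have main: "real (2 * j + 1) ^ d * ?s \<le>
      (real (2 * ?n + 1) ^ d - real (2 * ?n - 1) ^ d) * (b * ln q / (2 * (b - a)))"
    unfolding cardT of_nat_power .
  have J: "2 * real j + 1 > 0" by simp
  \<comment> \<open>Factoring out \<open>2 * j + 1\<close> leaves two powers that both tend to 1 as
    \<open>j\<close> grows.\<close>
  have n1: "real (2 * ?n + 1) = (2 * real j + 1) * (1 + 2 * real m / (2 * real j + 1))"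
    by (simp add: field_simps)
  have n2: "real (2 * ?n - 1) = (2 * real j + 1) * (1 + (2 * real m - 2) / (2 * real j + 1))"
    using j by (simp add: field_simps of_nat_diff)
  have "(2 * real j + 1) ^ d * ?s \<le> (2 * real j + 1) ^ d *
     (((1 + 2 * real m / (2 * real j + 1)) ^ d - (1 + (2 * real m - 2) / (2 * real j + 1)) ^ d) *
       (b * ln q / (2 * (b - a))))"
    using main unfolding n1 n2 power_mult_distrib by (simp add: algebra_simps)
  then show ?thesis using J by (simp only: mult_le_cancel_left_pos zero_less_power)
qed

text \<open>The scale \<open>j\<close> is fixed from \<open>\<epsilon>\<close> alone, so the
  estimate holds for every \<open>M\<close> beyond one threshold.\<close>

lemma eprob_wired_le_free:
  assumes q: "q \<ge> 1" and ab: "0 < a" "a < b" and e: "e \<in> Zd_edges d" and \<epsilon>: "\<epsilon> > 0"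
  shows "\<exists>M0. \<forall>M\<ge>M0. eprob_wired d q M a e \<le> eprob_free d q M b e + \<epsilon>"
proof -
  obtain m where m: "e \<in> box_edges d m" using in_some_box_edges[OF e] .
  define r where "r j = ((1 + 2 * real m / (2 * real j + 1)) ^ d - (1 + (2 * real m - 2) / (2 * real j + 1)) ^ d) *
       (b * ln q / (2 * (b - a)))" for j :: nat
  have "strict_mono (\<lambda>j::nat. 2 * j)" by (simp add: strict_mono_def)
  from LIMSEQ_subseq_LIMSEQ[OF LIMSEQ_inverse_real_of_nat this]
  have inv: "(\<lambda>j. inverse (2 * real j + 1)) \<longlonglongrightarrow> 0" by (simp add: o_def add.commute)
  have c: "(\<lambda>j. c / (2 * real j + 1)) \<longlonglongrightarrow> 0" for c
    using tendsto_mult_right_zero[OF inv, of c] by (simp add: divide_inverse)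
  have "r \<longlonglongrightarrow> ((1 + 0) ^ d - (1 + 0) ^ d) * (b * ln q / (2 * (b - a)))"
    unfolding r_def by (intro tendsto_intros c)
  then have "r \<longlonglongrightarrow> 0" by simp
  then have "eventually (\<lambda>j. r j < \<epsilon>) sequentially" using \<epsilon> by (rule order_tendstoD(2))
  with eventually_ge_at_top[of 1] have "eventually (\<lambda>j. r j < \<epsilon> \<and> j \<ge> 1) sequentially"
    by eventually_elim simp
  then obtain j where j: "r j < \<epsilon>" "j \<ge> 1" by (auto dest!: eventually_happens)
  have "eprob_wired d q M a e \<le> eprob_free d q M b e + \<epsilon>" if "M \<ge> m + 2 * j + 1" for M
    using eprob_gap_box[OF q ab m j(2), of M] j(1) that unfolding r_def[symmetric] by simp
  then show ?thesis by blast
qed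

section \<open>Jumps and exceptional parameters\<close>

lemma countable_right_jumps:
  fixes l :: "real \<Rightarrow> real"
  shows "countable {x. P x \<and> (\<exists>\<delta>>0. \<forall>b>x. P b \<longrightarrow> l x + \<delta> \<le> l b)}" (is "countable ?J")
proof -
  \<comment> \<open>A rational is placed inside each jump. For \<open>x < y\<close> the value
    \<open>l y\<close> separates the two chosen rationals, so the choice is injective.\<close>
  have "\<exists>r. l x < real_of_rat r \<and> (\<forall>b>x. P b \<longrightarrow> real_of_rat r < l b)" if "x \<in> ?J" for x
  proof -
    from that obtain \<delta> where \<delta>: "\<delta> > 0" "\<forall>b>x. P b \<longrightarrow> l x + \<delta> \<le> l b" by auto
    then obtain r where "l x < real_of_rat r" "real_of_rat r < l x + \<delta>"
      using of_rat_dense[of "l x" "l x + \<delta>"] by auto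
    with \<delta>(2) show ?thesis by (intro exI[of _ r]) force
  qed
  then have "\<forall>x\<in>?J. \<exists>r. l x < real_of_rat r \<and> (\<forall>b>x. P b \<longrightarrow> real_of_rat r < l b)" ..
  from bchoice[OF this] obtain r
    where r: "\<forall>x\<in>?J. l x < real_of_rat (r x) \<and> (\<forall>b>x. P b \<longrightarrow> real_of_rat (r x) < l b)" ..
  have "inj_on r ?J"
  proof (rule linorder_inj_onI)
    fix x y assume xy: "x < y" "x \<in> ?J" "y \<in> ?J"
    have "P y" using xy(3) by simp
    then have "real_of_rat (r x) < l y" using bspec[OF r xy(2)] xy(1) by simp
    also have "l y < real_of_rat (r y)" using bspec[OF r xy(3)] by simp
    finally have "real_of_rat (r x) < real_of_rat (r y)" .
    then show "r x \<noteq> r y" by auto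
  qed auto
  then show ?thesis by (rule countableI') 
qed

definition edge_gap_set :: "nat \<Rightarrow> real \<Rightarrow> int list set \<Rightarrow> real set" where
  "edge_gap_set d q e =
     {x. x > 0 \<and> \<not> (\<lambda>n. eprob_wired d q n x e - eprob_free d q n x e) \<longlonglongrightarrow> 0}"

text \<open>The function \<open>l\<close> is the limiting free edge probability, a supremum because
  free probabilities grow with the box. If \<open>x\<close> is not a right jump of \<open>l\<close>,
  some \<open>b > x\<close> has \<open>l b\<close> close to \<open>l x\<close>, and the wired
  probability at \<open>x\<close> is squeezed between the free ones at \<open>x\<close> and at
  \<open>b\<close>.\<close>

lemma countable_edge_gap_set:
  assumes q: "q \<ge> 1" and e: "e \<in> Zd_edges d"
  shows "countable (edge_gap_set d q e)"
proof -
  define N where "N = {n. e \<in> box_edges d n}"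
  define l where "l x = (SUP n\<in>N. eprob_free d q n x e)" for x
  obtain m where "e \<in> box_edges d m" using in_some_box_edges[OF e] .
  then have m: "n \<in> N" if "n \<ge> m" for n using box_edges_mono[OF that] by (auto simp: N_def)
  have bdd: "bdd_above ((\<lambda>n. eprob_free d q n x e) ` N)" if "x > 0" for x
    using cgraph.eprob_bounds(2)[OF cgraph_box q that] by (intro bdd_aboveI2[where M = 1])
  have upper: "eprob_free d q n x e \<le> l x" if "n \<ge> m" "x > 0" for n x
    unfolding l_def by (rule cSUP_upper[OF m[OF that(1)] bdd[OF that(2)]])
  have lower: "\<exists>M0. \<forall>M\<ge>M0. l x - \<epsilon> < eprob_free d q M x e" if x: "x > 0" and "\<epsilon> > 0" for x \<epsilon>
  proof -
    have "N \<noteq> {}" using m by blast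
    moreover have "l x - \<epsilon> < l x" using \<open>\<epsilon> > 0\<close> by simp
    ultimately obtain n where n: "n \<in> N" "l x - \<epsilon> < eprob_free d q n x e"
      unfolding l_def less_cSUP_iff[OF _ bdd[OF x]] using less_cSUP_iff[OF _ bdd[OF x]] by blast
    \<comment> \<open>Translation by the zero vector specialises \<open>eprob_translate\<close> to
      monotonicity in the box.\<close>
    have id: "shift (replicate d 0) ` e = e"
    proof -
      have "shift (replicate d 0) y = y" if "y \<in> e" for y
        using Zd_edges_length[OF e that] by (intro nth_equalityI) (auto simp: nth_shift)
      then show ?thesis by force
    qed
    have "eprob_free d q n x e \<le> eprob_free d q M x e" if "M > n" for M
      using eprob_translate(1)[OF q x replicate_in_box[of d 0], of n M e] that n(1) e
      by (simp add: id N_def)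
    then show ?thesis using n(2) by (intro exI[of _ "n + 1"] allI impI) (simp add: less_le_trans)
  qed
  have "edge_gap_set d q e \<subseteq> {x. x > 0 \<and> (\<exists>\<delta>>0. \<forall>b>x. b > 0 \<longrightarrow> l x + \<delta> \<le> l b)}"
  proof (rule subsetI, rule ccontr)
    fix x assume x: "x \<in> edge_gap_set d q e"
      and nj: "x \<notin> {x. x > 0 \<and> (\<exists>\<delta>>0. \<forall>b>x. b > 0 \<longrightarrow> l x + \<delta> \<le> l b)}"
    have x0: "x > 0" using x by (simp add: edge_gap_set_def)
    have "(\<lambda>n. eprob_wired d q n x e - eprob_free d q n x e) \<longlonglongrightarrow> 0"
    proof (rule LIMSEQ_I)
      fix r :: real assume r: "r > 0"
      \<comment> \<open>Three errors of size \<open>r / 4\<close> are spent: from \<open>l x\<close>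
        to \<open>l b\<close>, from wired at \<open>x\<close> to free at \<open>b\<close>, and from
        \<open>l x\<close> to the finite box.\<close>
      have r4: "r / 4 > 0" using r by simp
      have "\<not> (\<forall>b>x. b > 0 \<longrightarrow> l x + r / 4 \<le> l b)"
      proof
        assume "\<forall>b>x. b > 0 \<longrightarrow> l x + r / 4 \<le> l b"
        with r4 x0 have "x \<in> {x. x > 0 \<and> (\<exists>\<delta>>0. \<forall>b>x. b > 0 \<longrightarrow> l x + \<delta> \<le> l b)}" by blast
        with nj show False by contradiction
      qed
      then obtain b where b: "b > x" "l b < l x + r / 4" by (auto simp: not_le)
      have b0: "b > 0" using b x0 by simp
      obtain M1 where M1: "\<forall>M\<ge>M1. eprob_wired d q M x e \<le> eprob_free d q M b e + r / 4"
        using eprob_wired_le_free[OF q x0 b(1) e r4] by blast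
      obtain M2 where M2: "\<forall>M\<ge>M2. l x - r / 4 < eprob_free d q M x e" using lower[OF x0 r4] by blast
      have "norm (eprob_wired d q M x e - eprob_free d q M x e - 0) < r" if M: "M \<ge> max m (max M1 M2)" for M
      proof -
        interpret graph_quotient "box d M" "box_edges d M" "\<lambda>e. e" "wbox d M" "\<lambda>e. wire d M ` e" "wire d M" q
          by (rule graph_quotient_wire[OF q])
        have "e \<in> box_edges d M" using m[of M] M by (simp add: N_def)
        then have "eprob_free d q M x e \<le> eprob_wired d q M x e" using eprob_le[OF x0 order_refl] by simp
        moreover have "eprob_wired d q M x e \<le> eprob_free d q M b e + r / 4" using M1 M by simp
        moreover have "eprob_free d q M b e \<le> l b" using upper[OF _ b0] M by simp
        moreover have "l x - r / 4 < eprob_free d q M x e" using M2 M by simp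
        ultimately show ?thesis using b(2) by simp
      qed
      then show "\<exists>no. \<forall>n\<ge>no. norm (eprob_wired d q n x e - eprob_free d q n x e - 0) < r" by blast
    qed
    then show False using x by (simp add: edge_gap_set_def)
  qed
  then show ?thesis using countable_right_jumps countable_subset by blast
qed

lemma cyl_diff_le:
  assumes q: "q > 1" and p: "0 < p" "p < 1" and F: "F \<subseteq> box_edges d n" and \<xi>: "\<xi> \<in> F \<rightarrow>\<^sub>E {1, q}"
  shows "\<bar>cyl_wired d p q n F \<xi> - cyl_free d p q n F \<xi>\<bar>
    \<le> (\<Sum>e\<in>F. eprob_wired d q n (p / (1 - p)) e - eprob_free d q n (p / (1 - p)) e)"
proof -
  have q': "q \<ge> 1" and x: "p / (1 - p) > 0" using q p by auto
  interpret graph_quotient "box d n" "box_edges d n" "\<lambda>e. e" "wbox d n" "\<lambda>e. wire d n ` e" "wire d n" q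
    by (rule graph_quotient_wire[OF q'])
  show ?thesis
    unfolding cyl_wired_def cyl_free_def A.gprob_cylinder[OF assms] B.gprob_cylinder[OF assms]
    by (rule gmean_cylinder_diff[OF x F])
qed

text \<open>The two sequences converge to exactly the same numbers, so the descriptions defining
  \<open>lim\<close> coincide.\<close>

lemma lim_eq_if_diff_tendsto_0:
  fixes X Y :: "nat \<Rightarrow> real"
  assumes "(\<lambda>n. X n - Y n) \<longlonglongrightarrow> 0"
  shows "lim X = lim Y"
proof -
  have "(\<lambda>n. Y n - X n) \<longlonglongrightarrow> 0" using tendsto_minus[OF assms] by simp
  then have "X \<longlonglongrightarrow> L \<longleftrightarrow> Y \<longlonglongrightarrow> L" for L
    using Lim_transform[of X L sequentially Y] Lim_transform[of Y L sequentially X] assms by blast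
  then show ?thesis unfolding lim_def by simp
qed

lemma measures_eq:
  assumes q: "q \<ge> 1" and p: "0 < p" "p < 1"
    and ngap: "\<And>e. e \<in> Zd_edges d \<Longrightarrow> p / (1 - p) \<notin> edge_gap_set d q e"
  shows "\<not> measures_differ d p q"
proof -
  have "mu1 d p q F \<xi> = mu0 d p q F \<xi>" if F: "finite F" "F \<subseteq> Zd_edges d" and \<xi>: "\<xi> \<in> F \<rightarrow>\<^sub>E {1, q}" for F \<xi>
  proof (cases "q = 1")
    case True
    then show ?thesis
      unfolding mu0_def mu1_def cyl_wired_def cyl_free_def
      by (simp add: cgraph.gprob_trivial[OF cgraph_box p] cgraph.gprob_trivial[OF cgraph_wbox p])
  next
    case False
    then have q1: "q > 1" using q by simp
    let ?x = "p / (1 - p)"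
    let ?g = "\<lambda>n. \<Sum>e\<in>F. eprob_wired d q n ?x e - eprob_free d q n ?x e"
    have "?x > 0" using p by simp
    then have "(\<lambda>n. eprob_wired d q n ?x e - eprob_free d q n ?x e) \<longlonglongrightarrow> 0" if "e \<in> F" for e
      using ngap[of e] that F(2) by (auto simp: edge_gap_set_def)
    then have "?g \<longlonglongrightarrow> (\<Sum>e\<in>F. 0)" by (intro tendsto_sum)
    then have g: "?g \<longlonglongrightarrow> 0" by simp
    have "\<exists>n. F \<subseteq> box_edges d n" using F
    proof (induction F rule: finite_induct)
      case (insert e F)
      then obtain n where n: "F \<subseteq> box_edges d n" by auto
      obtain k where k: "e \<in> box_edges d k" using in_some_box_edges[of e d] insert.prems by auto
      have "insert e F \<subseteq> box_edges d (max n k)"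
        using n k box_edges_mono[of n "max n k" d] box_edges_mono[of k "max n k" d] by auto
      then show ?case by blast
    qed simp
    then obtain n0 where n0: "F \<subseteq> box_edges d n0" by blast
    have "(\<lambda>n. cyl_wired d p q n F \<xi> - cyl_free d p q n F \<xi>) \<longlonglongrightarrow> 0"
    proof (rule tendsto_0_le[OF g, where K = 1])
      have "norm (cyl_wired d p q n F \<xi> - cyl_free d p q n F \<xi>) \<le> norm (?g n) * 1" if "n \<ge> n0" for n
      proof -
        have "F \<subseteq> box_edges d n" using n0 box_edges_mono[OF that] by blast
        from cyl_diff_le[OF q1 p this \<xi>] show ?thesis by simp
      qed
      then show "eventually (\<lambda>n. norm (cyl_wired d p q n F \<xi> - cyl_free d p q n F \<xi>) \<le> norm (?g n) * 1) sequentially"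
        unfolding eventually_sequentially by blast
    qed
    then show ?thesis unfolding mu0_def mu1_def by (rule lim_eq_if_diff_tendsto_0)
  qed
  then show ?thesis unfolding measures_differ_def by blast
qed

lemma countable_Zd_edges: "countable (Zd_edges d)"
proof (rule countable_subset)
  show "Zd_edges d \<subseteq> (\<lambda>(x, y). {x, y}) ` UNIV" unfolding Zd_edges_def by auto
qed simp

theorem theorem5p1:
  fixes d :: nat and q :: real
  assumes "d \<ge> 2" and "q \<ge> 1"
  shows "countable {p::real. 0 \<le> p \<and> p \<le> 1 \<and> measures_differ d p q}"
proof -
  let ?G = "\<Union>e\<in>Zd_edges d. edge_gap_set d q e"
  \<comment> \<open>The map \<open>x / (1 + x)\<close> inverts the odds. The endpoints are set
    aside: \<open>p = 0\<close> gives odds 0 and \<open>p = 1\<close> gives no finite odds.\<close>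
  have "{p. 0 \<le> p \<and> p \<le> 1 \<and> measures_differ d p q} \<subseteq> {0, 1} \<union> (\<lambda>x. x / (1 + x)) ` ?G"
  proof
    fix p assume "p \<in> {p. 0 \<le> p \<and> p \<le> 1 \<and> measures_differ d p q}"
    then have p: "0 \<le> p" "p \<le> 1" "measures_differ d p q" by auto
    show "p \<in> {0, 1} \<union> (\<lambda>x. x / (1 + x)) ` ?G"
    proof (cases "p = 0 \<or> p = 1")
      case False
      then have p01: "0 < p" "p < 1" using p by auto
      then have "p / (1 - p) \<in> ?G" using measures_eq[OF assms(2) p01] p(3) by blast
      moreover have "p = (p / (1 - p)) / (1 + p / (1 - p))" using p01 by (simp add: field_simps)
      ultimately show ?thesis by blast
    qed auto
  qed
  moreover have "countable ({0, 1} \<union> (\<lambda>x. x / (1 + x)) ` ?G)"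
    using countable_edge_gap_set[OF assms(2)] countable_Zd_edges by auto
  ultimately show ?thesis by (rule countable_subset)
qed

end
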